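(* Let $0<|q|<1$, $\lambda\in\mathbb{C}^*\setminus q^{\mathbb{Z}}$, and let $\widetilde{\psi}^{\mathrm{B}}_\lambda(x)=\left(\mathcal{L}^+_{q,\lambda}\circ\mathcal{B}^+_q\,{}_1\psi_0\right)(a;-;q,x)$ be the $q$-Borel-Laplace transform of the divergent bilateral series ${}_1\psi_0(a;-;q,x)=\sum_{n\in\mathbb{Z}}(a;q)_n(-1)^nq^{-\frac{n(n-1)}{2}}x^n$ with $a=q^\alpha$. Then for any $x\in\mathbb{C}^*$, $$\lim_{q\to1-0}\widetilde{\psi}^{\mathrm{B}}_\lambda\!\left(\frac{x}{1-q}\right)=\Gamma(1-\alpha)\,x^{-\alpha}\,e^{\frac1x}.$$
   Context: Notation. $(a;q)_0=1$, $(a;q)_n=(1-a)(1-aq)\cdots(1-aq^{n-1})$ for $n\ge1$, $(a;q)_n=\left[(1-aq^{-1})(1-aq^{-2})\cdots(1-aq^{n})\right]^{-1}$ for $n\le-1$, and $(a;q)_\infty=\lim_{n\to\infty}(a;q)_n$. The theta function is $\theta_q(z)=\sum_{n\in\mathbb{Z}}q^{n(n-1)/2}z^n$ for $z\in\mathbb{C}^*$. $\Gamma$ is the gamma function. $q$-Borel transformation: $(\mathcal{B}^+_qf)(\xi)=\sum_n a_nq^{n(n-1)/2}\xi^n$ for a formal series $f(x)=\sum_n a_nx^n$, applied here termwise to a bilateral series ($n\in\mathbb{Z}$). It sends ${}_1\psi_0(a;-;q,x)$ to $\psi_{\mathrm{B}}(\xi)=\sum_{n\in\mathbb{Z}}(a;q)_n(-\xi)^n$,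 which is evaluated, by Ramanujan's ${}_1\psi_1$ summation, as $\psi_{\mathrm{B}}(\xi)=\frac{(q;q)_\infty}{(q/a;q)_\infty}\frac{\theta_q(a\xi)}{\theta_q(\xi)}\left(-\frac{q}{\xi};q\right)_\infty$. $q$-Laplace transformation: $(\mathcal{L}^+_{q,\lambda}\varphi)(x)=\sum_{n\in\mathbb{Z}}\frac{\varphi(\lambda q^n)}{\theta_q(\lambda q^n/x)}$. Thus $\widetilde{\psi}^{\mathrm{B}}_\lambda(x)=\sum_{n\in\mathbb{Z}}\frac{\psi_{\mathrm{B}}(\lambda q^n)}{\theta_q(\lambda q^n/x)}$.
   Formalization: Instead of λ∉q^Z and any x∈C*, λ and x/λ must not be negative reals (theta zeros lie on -q^Z; there the sum is undefined or has no limit); α is not a positive integer (Γ(1-α) finite); x^{-α} is the branch with |arg x - Arg λ|<π, as the principal one can fail. *)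

theory Defs
  imports "HOL-Complex_Analysis.Complex_Analysis"
begin

definition qpoch :: "complex \<Rightarrow> complex \<Rightarrow> int \<Rightarrow> complex" where
  "qpoch a q n =
     (if n \<ge> 0 then \<Prod>k<nat n. (1 - a * q ^ k)
      else inverse (\<Prod>k=1..nat (- n). (1 - a * q powi (- int k))))"

definition theta :: "complex \<Rightarrow> complex \<Rightarrow> complex" where
  "theta q z = (\<Sum>\<^sub>\<infinity>n::int. q powi (n * (n - 1) div 2) * z powi n)"

text \<open>A formal bilateral series is represented by its family of coefficients.\<close>

definition psi10 :: "complex \<Rightarrow> complex \<Rightarrow> int \<Rightarrow> complex" where
  "psi10 a q n = qpoch a q n * (- 1) powi n * q powi (- (n * (n - 1) div 2))"

definition qBorel :: "complex \<Rightarrow> (int \<Rightarrow> complex) \<Rightarrow> int \<Rightarrow> complex" where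
  "qBorel q c n = c n * q powi (n * (n - 1) div 2)"

text \<open>
  The Borel transform of the series above converges only for \<open>0 < |\<xi>| < 1\<close>, while the
  Laplace transform evaluates it along a whole spiral \<open>\<lambda> q\<^sup>n\<close>, \<open>n \<in> \<int>\<close>. The function meant is the
  meromorphic continuation to the punctured plane of the sum near the origin. It is unique (if it
  exists) by the identity theorem, because nicely meromorphic functions have their removable
  singularities removed and take the value 0 at their poles.
\<close>

definition laurent_continuation :: "(int \<Rightarrow> complex) \<Rightarrow> complex \<Rightarrow> complex" where
  "laurent_continuation b =
     (SOME \<phi>. \<phi> nicely_meromorphic_on (- {0}) \<and>
        (\<forall>\<^sub>F \<xi> in at 0. ((\<lambda>n. b n * \<xi> powi n) has_sum \<phi> \<xi>) UNIV))"

definition qLaplace :: "complex \<Rightarrow> complex \<Rightarrow> (complex \<Rightarrow> complex) \<Rightarrow> complex \<Rightarrow> complex" where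
  "qLaplace q l \<phi> x = (\<Sum>\<^sub>\<infinity>n::int. \<phi> (l * q powi n) / theta q (l * q powi n / x))"

definition qBorelLaplace :: "complex \<Rightarrow> complex \<Rightarrow> (int \<Rightarrow> complex) \<Rightarrow> complex \<Rightarrow> complex" where
  "qBorelLaplace q l c = qLaplace q l (laurent_continuation (qBorel q c))"

text \<open>
  The power \<open>x\<^sup>s\<close> on the plane cut along the ray from 0 through \<open>- l\<close>: the logarithm of \<open>x\<close> used is
  the one with imaginary part in \<open>(Arg l - \<pi>, Arg l + \<pi>)\<close>. For \<open>l > 0\<close> it is the principal power.
\<close>

definition powr_along :: "complex \<Rightarrow> complex \<Rightarrow> complex \<Rightarrow> complex" where
  "powr_along l x s = exp (s * (Ln l + Ln (x / l)))"

lemma powr_along_eq_powr: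
  assumes "l \<noteq> 0" "x \<noteq> 0" "\<bar>Arg x - Arg l\<bar> < pi"
  shows "powr_along l x s = x powr s"
proof -
  have "Ln (x / l) = Ln x - Ln l"
  proof (rule Ln_unique)
    show "exp (Ln x - Ln l) = x / l"
      using assms by (simp add: exp_diff)
  qed (use assms in \<open>auto simp: Arg_eq_Im_Ln\<close>)
  thus ?thesis
    using assms by (simp add: powr_along_def powr_def)
qed

end

theory Submission
  imports Defs "HOL-Real_Asymp.Real_Asymp"
begin

text \<open>
  Ramanujan's summation, in the case where the lower parameter is \<open>0\<close>, is applied twice: it gives
  the continuation of the Borel transform, and, after the theta functions in the Laplace transform
  are reduced by quasi-periodicity, the remaining sum over the spiral is again of this type, with
  \<open>a\<close> replaced by \<open>- \<lambda>\<close>. With the Jacobi triple product this leaves the closed form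
  \[ \frac{\theta_q(a\lambda)}{\theta_q(\lambda)} \cdot
     \frac{\theta_q(\lambda/(ax))}{\theta_q(\lambda/x)} \cdot
     \frac{(q;q)_\infty}{(q/a;q)_\infty} \cdot \frac{1}{(1/(ax);q)_\infty}, \]
  in which \<open>x\<close> stands for \<open>x / (1 - q)\<close>. As \<open>q \<rightarrow> 1\<close> the first two factors tend to powers, the third
  is a \<open>q\<close>-Gamma function and the last one a \<open>q\<close>-exponential. The powers and the Gamma function
  come from the same estimate: with \<open>q = exp (- t)\<close>, the logarithm of
  \<open>(- z q\<^sup>\<alpha>; q)\<^sub>\<infinity> / (- z; q)\<^sub>\<infinity>\<close> is compared factor by factor, to second order in \<open>t\<close>, with \<open>\<alpha>\<close> times
  the telescoping sum that belongs to \<open>\<alpha> = 1\<close>.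
\<close>

section \<open>Euler's product\<close>

text \<open>Representing the infinite products by Euler's power series gives holomorphy and
  continuity at once, and turns Ramanujan's summation into a comparison of coefficients. As q tends
  to 1 the individual products have no useful limit. Apart from the q-exponential, only quotients
  whose arguments differ by a power q^\<alpha> are passed to the limit, and the closed form is
  grouped accordingly. The estimate of their logarithms needs 1 + z to stay off the slit
  \<open>\<real>\<^sub>\<le>\<^sub>0\<close>; for the theta quotients this means that
  \<open>l\<close> and \<open>l / x\<close> stay off it. The q-Gamma quotient is the critical case,
  since there z tends to -1. In the regular case the second derivatives of the logarithms sum to
  O(1/t), so the error, t^2 times that sum, vanishes. Near the singularity they sum to order 1/t^2:
  the error no longer vanishes with t, and becomes small, uniformly in t, only after many factors
  have been removed. This forces two successive limits, first in t and then in the number of removed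
  factors.\<close>

text \<open>These are the numbers q^(k(k-1)/2) / (q;q)_k, written as products of the ratios of
  consecutive ones.\<close>

definition euler_coeff :: "complex \<Rightarrow> nat \<Rightarrow> complex" where
  "euler_coeff q k = (\<Prod>j<k. q ^ j / (1 - q ^ Suc j))"

text \<open>By Euler's identity this is the infinite product \<open>(- z; q)\<^sub>\<infinity>\<close>.\<close>

definition qprod :: "complex \<Rightarrow> complex \<Rightarrow> complex" where
  "qprod q z = (\<Sum>k. euler_coeff q k * z ^ k)"

lemma euler_coeff_0 [simp]: "euler_coeff q 0 = 1"
  by (simp add: euler_coeff_def)

lemma euler_coeff_Suc: "euler_coeff q (Suc k) = euler_coeff q k * (q ^ k / (1 - q ^ Suc k))"
  by (simp add: euler_coeff_def)

lemma qprod_0 [simp]: "qprod q 0 = 1"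
  unfolding qprod_def by (subst powser_zero) simp

lemma abs_summable_on_int:
  fixes f :: "int \<Rightarrow> complex"
  assumes "summable (\<lambda>n. norm (f (int n)))" "summable (\<lambda>n. norm (f (- int n)))"
  shows   "(\<lambda>n. norm (f n)) summable_on UNIV"
proof -
  have 1: "(\<lambda>n. norm (f n)) summable_on (range int)"
    by (subst summable_on_reindex)
       (use assms(1) in \<open>auto simp: o_def intro!: norm_summable_imp_summable_on\<close>)
  have 2: "(\<lambda>n. norm (f n)) summable_on ((\<lambda>n. - int n) ` {0<..})"
    by (subst summable_on_reindex)
       (use assms(2) in \<open>auto simp: o_def inj_on_def intro: summable_on_subset_banach
          dest!: norm_summable_imp_summable_on[of "\<lambda>n. norm (f (- int n))", simplified]\<close>)
  have "n \<in> range int \<union> (\<lambda>n. - int n) ` {0<..}" for n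
    by (cases n rule: int_cases) (auto intro!: image_eqI[of _ _ "Suc _"])
  hence eq: "range int \<union> (\<lambda>n. - int n) ` {0<..} = UNIV"
    by blast
  have "(\<lambda>n. norm (f n)) summable_on (range int \<union> (\<lambda>n. - int n) ` {0<..})"
    by (intro summable_on_Un_disjoint 1 2) auto
  thus ?thesis
    by (simp only: eq)
qed

text \<open>The ratio enters as a multiplier and not as a quotient of terms, because the series at
  hand may terminate and have vanishing terms.\<close>

lemma summable_norm_ratio_tendsto:
  fixes f r :: "nat \<Rightarrow> complex"
  assumes "\<And>n. f (Suc n) = r n * f n" "r \<longlonglongrightarrow> c" "norm c < 1"
  shows   "summable (\<lambda>n. norm (f n))"
proof -
  obtain d where d: "norm c < d" "d < 1"
    using assms(3) dense by blast
  have "(\<lambda>n. norm (r n)) \<longlonglongrightarrow> norm c"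
    by (intro tendsto_norm assms)
  hence "eventually (\<lambda>n. norm (r n) < d) sequentially"
    using d by (intro order_tendstoD(2)) auto
  then obtain N where N: "\<And>n. n \<ge> N \<Longrightarrow> norm (r n) < d"
    by (auto simp: eventually_at_top_linorder)
  show ?thesis
  proof (rule summable_ratio_test[OF d(2), of N])
    fix n assume "n \<ge> N"
    thus "norm (norm (f (Suc n))) \<le> d * norm (norm (f n))"
      using N[of n] by (auto simp: assms(1) norm_mult intro!: mult_right_mono)
  qed
qed

locale nome =
  fixes q :: complex
  assumes q_nz: "q \<noteq> 0" and norm_q: "norm q < 1"
begin

lemma q_power_tendsto_0: "(\<lambda>n. q ^ n) \<longlonglongrightarrow> 0"
  using norm_q by (rule LIMSEQ_power_zero)

lemma q_power_neq_1: "q ^ Suc n \<noteq> 1"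
proof
  assume "q ^ Suc n = 1"
  hence "norm q ^ Suc n = 1" by (metis norm_one norm_power)
  thus False using norm_q power_Suc_less_one[of "norm q" n] 
    by (metis less_irrefl norm_ge_zero power_less_one_iff zero_less_Suc)
qed

lemma q_power_Suc_tendsto_0: "(\<lambda>n. q ^ Suc n) \<longlonglongrightarrow> 0"
  using q_power_tendsto_0 by (rule LIMSEQ_Suc)

lemma summable_qprod: "summable (\<lambda>k. norm (euler_coeff q k * z ^ k))"
proof (rule summable_norm_ratio_tendsto)
  show "euler_coeff q (Suc n) * z ^ Suc n = (q ^ n / (1 - q ^ Suc n) * z) * (euler_coeff q n * z ^ n)" for n
    by (simp add: euler_coeff_Suc)
  have "(\<lambda>n. q ^ n / (1 - q ^ Suc n) * z) \<longlonglongrightarrow> 0 / (1 - 0) * z"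
    by (intro tendsto_intros q_power_tendsto_0 q_power_Suc_tendsto_0) auto
  thus "(\<lambda>n. q ^ n / (1 - q ^ Suc n) * z) \<longlonglongrightarrow> 0" by simp
qed auto

lemma qprod_sums: "(\<lambda>k. euler_coeff q k * z ^ k) sums qprod q z"
  unfolding qprod_def using summable_norm_cancel[OF summable_qprod] by (simp add: summable_sums)

lemma qprod_has_sum: "((\<lambda>k. euler_coeff q k * z ^ k) has_sum qprod q z) UNIV"
  by (intro norm_summable_imp_has_sum summable_qprod qprod_sums)

lemma euler_coeff_rec: "euler_coeff q (Suc k) = q ^ Suc k * euler_coeff q (Suc k) + q ^ k * euler_coeff q k"
  using q_power_neq_1[of k] by (simp add: euler_coeff_Suc field_simps)

text \<open>This is \<open>euler_coeff_rec\<close> summed against z^k: the two terms on its right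
  come from \<open>qprod q (q * z)\<close> and from z times it.\<close>

lemma qprod_rec: "qprod q z = (1 + z) * qprod q (q * z)"
proof -
  have 1: "(\<lambda>k. euler_coeff q k * (q * z) ^ k) sums qprod q (q * z)"
    by (rule qprod_sums)
  hence 2: "(\<lambda>k. z * (euler_coeff q k * (q * z) ^ k)) sums (z * qprod q (q * z))"
    by (intro sums_mult)
  have 3: "(\<lambda>k. euler_coeff q (Suc k) * (q * z) ^ (Suc k)) sums (qprod q (q * z) - 1)"
    using 1 by (subst sums_Suc_iff) auto
  have 4: "(\<lambda>k. euler_coeff q (Suc k) * z ^ (Suc k)) sums (qprod q z - 1)"
    using qprod_sums[of z] by (subst sums_Suc_iff) auto
  have "(\<lambda>k. euler_coeff q (Suc k) * (q * z) ^ (Suc k) + z * (euler_coeff q k * (q * z) ^ k))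
          sums (qprod q (q * z) - 1 + z * qprod q (q * z))"
    by (intro sums_add 2 3)
  also have "(\<lambda>k. euler_coeff q (Suc k) * (q * z) ^ (Suc k) + z * (euler_coeff q k * (q * z) ^ k)) =
             (\<lambda>k. euler_coeff q (Suc k) * z ^ (Suc k))"
    by (subst (2) euler_coeff_rec) (simp add: algebra_simps power_mult_distrib)
  finally have "qprod q (q * z) - 1 + z * qprod q (q * z) = qprod q z - 1"
    using 4 sums_unique2 by blast
  thus ?thesis by (simp add: algebra_simps)
qed

lemma qprod_rec_power: "qprod q z = (\<Prod>k<n. 1 + z * q ^ k) * qprod q (z * q ^ n)"
proof (induction n)
  case (Suc n)
  thus ?case
    by (subst (asm) (2) qprod_rec) (simp add: mult_ac)
qed auto

lemma holomorphic_qprod: "qprod q holomorphic_on A"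
proof -
  have "(qprod q has_field_derivative (\<Sum>n. diffs (euler_coeff q) n * z ^ n)) (at z)" for z
    unfolding qprod_def using summable_norm_cancel[OF summable_qprod]
    by (intro termdiffs_strong_converges_everywhere)
  hence "qprod q holomorphic_on UNIV"
    using holomorphic_on_open by blast
  thus ?thesis
    by (rule holomorphic_on_subset) auto
qed

lemma isCont_qprod: "isCont (qprod q) z"
  using holomorphic_qprod[of UNIV] holomorphic_on_imp_continuous_on continuous_on_eq_continuous_at
  by (metis UNIV_I open_UNIV)

lemma qprod_shift_tendsto: "(\<lambda>n. qprod q (z * q ^ n)) \<longlonglongrightarrow> 1"
proof -
  have "(\<lambda>n. z * q ^ n) \<longlonglongrightarrow> 0"
    using tendsto_mult_left[OF q_power_tendsto_0, of z] by simp
  from isCont_tendsto_compose[OF isCont_qprod this] show ?thesis by simp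
qed

text \<open>Euler's identity. Peeling off n factors leaves \<open>qprod q (z * q ^ n)\<close>, which
  tends to the value 1 at the origin by continuity, so that one may divide by it for large
  n.\<close>

lemma qprod_LIMSEQ: "(\<lambda>n. \<Prod>k<n. 1 + z * q ^ k) \<longlonglongrightarrow> qprod q z"
proof -
  have ev: "eventually (\<lambda>n. qprod q (z * q ^ n) \<noteq> 0) sequentially"
    using qprod_shift_tendsto[of z] by (rule tendsto_imp_eventually_ne) auto
  have "(\<lambda>n. qprod q z / qprod q (z * q ^ n)) \<longlonglongrightarrow> qprod q z / 1"
    by (intro tendsto_intros qprod_shift_tendsto) auto
  moreover have "eventually (\<lambda>n. qprod q z / qprod q (z * q ^ n) = (\<Prod>k<n. 1 + z * q ^ k)) sequentially"
    using ev by eventually_elim (use qprod_rec_power[of z] in \<open>simp add: field_simps\<close>)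
  ultimately show ?thesis
    using tendsto_cong by fastforce
qed

lemma qprod_nonzero:
  assumes "\<And>k. 1 + z * q ^ k \<noteq> 0"
  shows   "qprod q z \<noteq> 0"
proof -
  have ev: "eventually (\<lambda>n. qprod q (z * q ^ n) \<noteq> 0) sequentially"
    using qprod_shift_tendsto[of z] by (rule tendsto_imp_eventually_ne) auto
  then obtain n where "qprod q (z * q ^ n) \<noteq> 0"
    using eventually_happens by fastforce
  thus ?thesis
    using assms by (subst qprod_rec_power[of _ n]) auto
qed

lemma qprod_nonzero_ball:
  assumes "norm z < 1"
  shows   "qprod q z \<noteq> 0"
proof (rule qprod_nonzero)
  fix k
  have "norm (z * q ^ k) \<le> norm z * 1"
    unfolding norm_mult using norm_q
    by (intro mult_left_mono) (auto simp: norm_power intro: power_le_one)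
  with assms have "norm (z * q ^ k) < 1" by simp
  thus "1 + z * q ^ k \<noteq> 0"
    by (metis add_eq_0_iff less_irrefl norm_minus_cancel norm_one)
qed

lemma qprod_minus_q_nz: "qprod q (- q) \<noteq> 0"
  by (rule qprod_nonzero) (use q_power_neq_1 in auto)

end

section \<open>Ramanujan's summation\<close>

lemma triangle_Suc: "(n + 1) * (n + 1 - 1) div 2 = n * (n - 1) div 2 + (n :: int)"
proof -
  have "(n + 1) * (n + 1 - 1) = n * (n - 1) + n * 2"
    by (simp add: algebra_simps)
  thus ?thesis
    by simp
qed

text \<open>If a were a positive power of q, a factor of the inverted product would vanish at some
  negative index; with \<open>inverse 0 = 0\<close> the recurrence would break there.\<close>

lemma qpoch_Suc:
  assumes "q \<noteq> 0" "\<And>k. a \<noteq> q ^ Suc k"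
  shows   "qpoch a q (n + 1) = (1 - a * q powi n) * qpoch a q n"
proof (cases "n \<ge> 0")
  case True
  then obtain m where n: "n = int m"
    using nonneg_int_cases by blast
  have *: "nat (int m + 1) = Suc m" by simp
  show ?thesis
    unfolding n qpoch_def * by (simp add: power_int_def mult.commute)
next
  case False
  then obtain m where n: "n = - int (Suc m)"
    using neg_int_cases by (metis not_less gr0_implies_Suc)
  have nz: "1 - a * q powi (- int (Suc m)) \<noteq> 0"
    using assms by (auto simp: power_int_minus field_simps simp del: power_Suc of_nat_Suc)
  have "qpoch a q (n + 1) = inverse (\<Prod>k=1..m. 1 - a * q powi (- int k))"
    by (cases m) (auto simp: n qpoch_def nat_add_distrib)
  moreover have "qpoch a q n = inverse (\<Prod>k=1..m. 1 - a * q powi (- int k)) *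
                   inverse (1 - a * q powi (- int (Suc m)))"
    by (simp add: n qpoch_def del: of_nat_Suc)
  ultimately show ?thesis
    using nz by (simp add: n del: of_nat_Suc)
qed

context nome
begin

abbreviation psi_coeff :: "complex \<Rightarrow> int \<Rightarrow> complex" where
  "psi_coeff a \<equiv> qBorel q (psi10 a q)"

lemma psi_coeff_eq: "psi_coeff a n = qpoch a q n * (- 1) powi n"
  using q_nz by (simp add: qBorel_def psi10_def power_int_minus)

lemma psi_coeff_0 [simp]: "psi_coeff a 0 = 1"
  by (simp add: psi_coeff_eq qpoch_def)

lemma psi_coeff_Suc:
  assumes "\<And>k. a \<noteq> q ^ Suc k"
  shows   "psi_coeff a (n + 1) = (a * q powi n - 1) * psi_coeff a n"
  unfolding psi_coeff_eq qpoch_Suc[OF q_nz assms] by (simp add: power_int_add algebra_simps)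

lemma psi_coeff_minus_Suc:
  assumes "\<And>k. a \<noteq> q ^ Suc k"
  shows   "psi_coeff a (- int (Suc n)) = q ^ Suc n / (a - q ^ Suc n) * psi_coeff a (- int n)"
proof -
  have "psi_coeff a (- int n) = (a * q powi (- int (Suc n)) - 1) * psi_coeff a (- int (Suc n))"
    using psi_coeff_Suc[OF assms, of "- int (Suc n)"] by simp
  also have "a * q powi (- int (Suc n)) - 1 = (a - q ^ Suc n) / q ^ Suc n"
    using q_nz by (simp add: power_int_minus field_simps del: of_nat_Suc power_Suc)
  finally show ?thesis
    using assms[of n] q_nz by (simp add: field_simps del: of_nat_Suc power_Suc)
qed

text \<open>The ratio of consecutive terms tends to \<open>- \<xi>\<close> in the positive direction
  and to 0 in the negative one, so the upper bound on the norm of \<open>\<xi>\<close> comes from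
  the positive half alone.\<close>

lemma psi_abs_summable:
  assumes a: "a \<noteq> 0" "\<And>k. a \<noteq> q ^ Suc k" and \<xi>: "\<xi> \<noteq> 0" "norm \<xi> < 1"
  shows   "(\<lambda>n. norm (psi_coeff a n * \<xi> powi n)) summable_on UNIV"
proof (rule abs_summable_on_int)
  show "summable (\<lambda>n. norm (psi_coeff a (int n) * \<xi> powi int n))"
  proof (rule summable_norm_ratio_tendsto)
    show "psi_coeff a (int (Suc n)) * \<xi> powi int (Suc n) =
            ((a * q ^ n - 1) * \<xi>) * (psi_coeff a (int n) * \<xi> powi int n)" for n
      using psi_coeff_Suc[OF a(2), of "int n"] \<xi> by (simp add: power_int_add add.commute mult_ac)
    have "(\<lambda>n. (a * q ^ n - 1) * \<xi>) \<longlonglongrightarrow> (a * 0 - 1) * \<xi>"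
      by (intro tendsto_intros q_power_tendsto_0)
    thus "(\<lambda>n. (a * q ^ n - 1) * \<xi>) \<longlonglongrightarrow> - \<xi>" by simp
  qed (use \<xi> in auto)
  show "summable (\<lambda>n. norm (psi_coeff a (- int n) * \<xi> powi (- int n)))"
  proof (rule summable_norm_ratio_tendsto)
    show "psi_coeff a (- int (Suc n)) * \<xi> powi (- int (Suc n)) =
            (q ^ Suc n / (a - q ^ Suc n) / \<xi>) * (psi_coeff a (- int n) * \<xi> powi (- int n))" for n
      unfolding psi_coeff_minus_Suc[OF a(2)] using \<xi>
      by (simp add: power_int_minus power_int_def divide_inverse mult_ac nat_add_distrib)
    have "(\<lambda>n. q ^ Suc n / (a - q ^ Suc n) / \<xi>) \<longlonglongrightarrow> 0 / (a - 0) / \<xi>"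
      by (intro tendsto_intros q_power_Suc_tendsto_0) (use a \<xi> in auto)
    thus "(\<lambda>n. q ^ Suc n / (a - q ^ Suc n) / \<xi>) \<longlonglongrightarrow> 0" by simp
  qed auto
qed

section \<open>The product of the bilateral series with Euler's product\<close>

text \<open>The coefficient of \<xi>^N in the Cauchy product of the bilateral series with
  \<open>qprod q \<xi>\<close>. Multiplying by \<open>qprod q \<xi>\<close> clears the expected
  denominator, so these should be the coefficients of a theta series.\<close>

definition psi_prod :: "complex \<Rightarrow> int \<Rightarrow> complex" where
  "psi_prod a N = (\<Sum>\<^sub>\<infinity>k. euler_coeff q k * psi_coeff a (N - int k))"

lemma psi_prod_has_sum:
  assumes a: "a \<noteq> 0" "\<And>k. a \<noteq> q ^ Suc k" and \<xi>: "\<xi> \<noteq> 0" "norm \<xi> < 1"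
  shows   "((\<lambda>N. psi_prod a N * \<xi> powi N) has_sum
             ((\<Sum>\<^sub>\<infinity>n. psi_coeff a n * \<xi> powi n) * qprod q \<xi>)) UNIV"
    and   "(\<lambda>k. norm (euler_coeff q k * psi_coeff a (N - int k))) summable_on UNIV"
proof -
  define B where "B = (\<Sum>\<^sub>\<infinity>n. psi_coeff a n * \<xi> powi n)"
  define f where "f = (\<lambda>(n, k). (psi_coeff a n * \<xi> powi n) * (euler_coeff q k * \<xi> ^ k))"
  define h where "h = (\<lambda>(N, k). (euler_coeff q k * psi_coeff a (N - int k)) * \<xi> powi N)"
  have B: "((\<lambda>n. psi_coeff a n * \<xi> powi n) has_sum B) UNIV"
    unfolding B_def by (rule has_sum_infsum[OF abs_summable_summable[OF psi_abs_summable[OF a \<xi>]]])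
  have E: "(\<lambda>k. norm (euler_coeff q k * \<xi> ^ k)) summable_on UNIV"
    by (intro norm_summable_imp_summable_on) (simp add: summable_qprod)
  have f_abs: "(\<lambda>x. norm (f x)) summable_on (UNIV \<times> UNIV)"
  proof (subst Infinite_Sum.abs_summable_on_Sigma_iff, intro conjI ballI)
    show "(\<lambda>y. norm (f (x, y))) summable_on UNIV" for x
      unfolding f_def case_prod_conv norm_mult[of "psi_coeff _ _ * _"]
      by (intro summable_on_cmult_right E)
    have "(\<lambda>x. norm (norm (psi_coeff a x * \<xi> powi x) * (\<Sum>\<^sub>\<infinity>k. norm (euler_coeff q k * \<xi> ^ k))))
            summable_on UNIV"
      using summable_on_cmult_left[OF psi_abs_summable[OF a \<xi>]] 
      by (simp add: abs_mult infsum_nonneg)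
    thus "(\<lambda>x. norm (\<Sum>\<^sub>\<infinity>y. norm (f (x, y)))) summable_on UNIV"
      unfolding f_def case_prod_conv norm_mult[of "psi_coeff _ _ * _"] infsum_cmult_right' .
  qed
  have "(f has_sum (B * qprod q \<xi>)) (UNIV \<times> UNIV)"
  proof (rule has_sum_SigmaI)
    show "((\<lambda>y. f (x, y)) has_sum (psi_coeff a x * \<xi> powi x * qprod q \<xi>)) UNIV" for x
      unfolding f_def case_prod_conv by (intro has_sum_cmult_right qprod_has_sum)
    show "((\<lambda>x. psi_coeff a x * \<xi> powi x * qprod q \<xi>) has_sum (B * qprod q \<xi>)) UNIV"
      by (intro has_sum_cmult_left B)
    show "f summable_on UNIV \<times> UNIV"
      using f_abs by (rule abs_summable_summable)
  qed
  \<comment> \<open>The shear (n, k) to (n + k, k) regroups the double series by total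
    degree.\<close>
  also have "?this \<longleftrightarrow> (h has_sum (B * qprod q \<xi>)) (UNIV \<times> UNIV)"
    by (rule has_sum_reindex_bij_witness[of _ "\<lambda>(N, k). (N - int k, k)" "\<lambda>(n, k). (n + int k, k)"])
       (use \<xi> in \<open>auto simp: f_def h_def power_int_add\<close>)
  finally have h: "(h has_sum (B * qprod q \<xi>)) (UNIV \<times> UNIV)" .
  have "(\<lambda>x. norm (f x)) summable_on (UNIV \<times> UNIV) \<longleftrightarrow>
        (\<lambda>x. norm (h x)) summable_on (UNIV \<times> UNIV)"
    by (rule summable_on_reindex_bij_witness[of _ "\<lambda>(N, k). (N - int k, k)" "\<lambda>(n, k). (n + int k, k)"])
       (use \<xi> in \<open>auto simp: f_def h_def power_int_add norm_mult mult_ac\<close>)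
  with f_abs have h_abs: "(\<lambda>x. norm (h x)) summable_on (UNIV \<times> UNIV)"
    by simp
  have sm: "(\<lambda>k. norm (euler_coeff q k * psi_coeff a (N - int k))) summable_on UNIV" for N
  proof -
    have "(\<lambda>k. norm (h (N, k))) summable_on UNIV"
      using h_abs[unfolded Infinite_Sum.abs_summable_on_Sigma_iff] by blast
    thus ?thesis
      using \<xi> by (subst (asm) h_def) (simp add: norm_mult summable_on_cmult_left')
  qed
  thus "(\<lambda>k. norm (euler_coeff q k * psi_coeff a (N - int k))) summable_on UNIV" .
  have "((\<lambda>k. h (N, k)) has_sum (psi_prod a N * \<xi> powi N)) UNIV" for N
    unfolding h_def case_prod_conv psi_prod_def
    by (intro has_sum_cmult_left has_sum_infsum abs_summable_summable[OF sm])
  from has_sum_SigmaD[OF h this]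
  show "((\<lambda>N. psi_prod a N * \<xi> powi N) has_sum (B * qprod q \<xi>)) UNIV" .
qed

lemma
  assumes a: "a \<noteq> 0" "\<And>k. a \<noteq> q ^ Suc k"
  shows   psi_prod_sums: "(\<lambda>k. euler_coeff q k * psi_coeff a (N - int k)) sums psi_prod a N"
    and   psi_prod_summable: "summable (\<lambda>k. norm (euler_coeff q k * psi_coeff a (N - int k)))"
proof -
  \<comment> \<open>The claim does not involve \<open>\<xi>\<close>, so any point of the punctured
    unit disc serves as witness.\<close>
  have *: "(\<lambda>k. norm (euler_coeff q k * psi_coeff a (N - int k))) summable_on UNIV"
    by (rule psi_prod_has_sum(2)[OF a, of "1/2"]) auto
  show "(\<lambda>k. euler_coeff q k * psi_coeff a (N - int k)) sums psi_prod a N"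
    unfolding psi_prod_def
    by (intro has_sum_imp_sums has_sum_infsum abs_summable_summable[OF *])
  show "summable (\<lambda>k. norm (euler_coeff q k * psi_coeff a (N - int k)))"
    using * summable_on_UNIV_nonneg_real_iff by (metis norm_ge_zero)
qed

text \<open>Let X and Y be the sums for N + 1 and N with an extra weight q^k. The recurrence of the
  Euler coefficients gives \<open>psi_prod a (N + 1) - X = Y\<close>; that of
  \<open>psi_coeff\<close>, in which q^k cancels against q^(N - k), gives
  \<open>X + Y = a * q powi N * psi_prod a N\<close>.\<close>

lemma psi_prod_rec:
  assumes a: "a \<noteq> 0" "\<And>k. a \<noteq> q ^ Suc k"
  shows   "psi_prod a (N + 1) = a * q powi N * psi_prod a N"
proof -
  have *: "summable (\<lambda>k. q ^ k * (euler_coeff q k * psi_coeff a (N - int k)))" for N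
  proof (rule summable_comparison_test'[OF psi_prod_summable[OF a, of N]])
    fix n
    have "norm (q ^ n) \<le> 1"
      using norm_q by (simp add: norm_power power_le_one)
    thus "norm (q ^ n * (euler_coeff q n * psi_coeff a (N - int n))) \<le>
            norm (euler_coeff q n * psi_coeff a (N - int n))"
      unfolding norm_mult[of "q ^ n"] by (intro mult_left_le_one_le) auto
  qed
  then obtain X Y
    where X: "(\<lambda>k. q ^ k * (euler_coeff q k * psi_coeff a (N + 1 - int k))) sums X"
      and Y: "(\<lambda>k. q ^ k * (euler_coeff q k * psi_coeff a (N - int k))) sums Y"
    by (meson summable_sums)
  have "(\<lambda>k. euler_coeff q k * psi_coeff a (N + 1 - int k) -
             q ^ k * (euler_coeff q k * psi_coeff a (N + 1 - int k))) sums (psi_prod a (N + 1) - X)"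
    by (intro sums_diff psi_prod_sums[OF a] X)
  \<comment> \<open>The term at k = 0 is zero because q^0 = 1, so dropping it does not change the
    sum.\<close>
  hence "(\<lambda>k. euler_coeff q (Suc k) * psi_coeff a (N + 1 - int (Suc k)) -
             q ^ (Suc k) * (euler_coeff q (Suc k) * psi_coeff a (N + 1 - int (Suc k)))) sums
           (psi_prod a (N + 1) - X)"
    by (subst sums_Suc_iff) simp
  also have "(\<lambda>k. euler_coeff q (Suc k) * psi_coeff a (N + 1 - int (Suc k)) -
             q ^ (Suc k) * (euler_coeff q (Suc k) * psi_coeff a (N + 1 - int (Suc k)))) =
             (\<lambda>k. q ^ k * (euler_coeff q k * psi_coeff a (N - int k)))"
    by (subst (1) euler_coeff_rec) (simp add: algebra_simps)
  finally have eq: "psi_prod a (N + 1) - X = Y"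
    using Y sums_unique2 by blast
  have "(\<lambda>k. q ^ k * (euler_coeff q k * psi_coeff a (N + 1 - int k)) +
             q ^ k * (euler_coeff q k * psi_coeff a (N - int k))) sums (X + Y)"
    by (intro sums_add X Y)
  also have "(\<lambda>k. q ^ k * (euler_coeff q k * psi_coeff a (N + 1 - int k)) +
             q ^ k * (euler_coeff q k * psi_coeff a (N - int k))) =
             (\<lambda>k. a * q powi N * (euler_coeff q k * psi_coeff a (N - int k)))"
  proof
    fix k
    have "psi_coeff a (N + 1 - int k) = (a * q powi (N - int k) - 1) * psi_coeff a (N - int k)"
      using psi_coeff_Suc[OF a(2), of "N - int k"] by (simp add: algebra_simps)
    hence "q ^ k * (psi_coeff a (N + 1 - int k) + psi_coeff a (N - int k)) =
             a * q powi N * psi_coeff a (N - int k)"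
      using q_nz by (simp add: power_int_diff field_simps)
    from arg_cong[OF this, of "\<lambda>u. euler_coeff q k * u"]
    show "q ^ k * (euler_coeff q k * psi_coeff a (N + 1 - int k)) +
             q ^ k * (euler_coeff q k * psi_coeff a (N - int k)) =
          a * q powi N * (euler_coeff q k * psi_coeff a (N - int k))"
      by (simp add: algebra_simps)
  qed
  finally have "X + Y = a * q powi N * psi_prod a N"
    using sums_mult[OF psi_prod_sums[OF a, of N]] sums_unique2 by blast
  thus ?thesis using eq by (simp add: algebra_simps)
qed

text \<open>The recurrence in N fixes everything except the constant \<open>psi_prod a 0\<close>,
  which remains to be found as a function of a.\<close>

lemma psi_prod_eq:
  assumes a: "a \<noteq> 0" "\<And>k. a \<noteq> q ^ Suc k"
  shows   "psi_prod a N = psi_prod a 0 * (q powi (N * (N - 1) div 2) * a powi N)"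
proof (induction N rule: int_induct[where k = 0])
  case base
  thus ?case by simp
next
  case (step1 i)
  show ?case
    unfolding psi_prod_rec[OF a] step1 triangle_Suc
    using a q_nz by (simp add: power_int_add)
next
  case (step2 i)
  have "a * q powi (i - 1) * psi_prod a (i - 1) = psi_prod a i"
    using psi_prod_rec[OF a, of "i - 1"] by simp
  also have "\<dots> = a * q powi (i - 1) * (psi_prod a 0 * (q powi ((i-1) * ((i-1) - 1) div 2) * a powi (i-1)))"
    unfolding step2 using triangle_Suc[of "i - 1"] a q_nz
    by (simp add: power_int_add power_int_diff)
  finally show ?case
    using a q_nz by simp
qed

text \<open>Both sides satisfy the same first-order recurrence in n. Descending to negative n
  divides by a factor that is nonzero because a is not a positive power of q.\<close>

lemma psi_coeff_shift:
  assumes a: "a \<noteq> 0" "\<And>k. a \<noteq> q ^ Suc k"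
  shows   "psi_coeff (a / q) (n + 1) = (a / q - 1) * psi_coeff a n"
proof -
  have a': "a / q \<noteq> q ^ Suc k" for k
    using a(2)[of "Suc k"] q_nz by (auto simp: field_simps)
  show ?thesis
  proof (induction n rule: int_induct[where k = 0])
    case base
    show ?case using psi_coeff_Suc[OF a', of 0] by simp
  next
    case (step1 i)
    show ?case
      unfolding psi_coeff_Suc[OF a', of "i + 1"] psi_coeff_Suc[OF a(2), of i] step1
      using q_nz by (simp add: power_int_add)
  next
    case (step2 i)
    then obtain m where m: "i - 1 = - int (Suc m)"
      by (metis add_diff_cancel_left' diff_add_cancel int_minus neg_int_cases not_less zle_diff1_eq le_less_trans diff_less_eq less_add_one gr0_implies_Suc)
    have nz: "a * q powi (i - 1) - 1 \<noteq> 0"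
      unfolding m using a(2)[of m] q_nz
      by (auto simp: power_int_minus field_simps simp del: power_Suc of_nat_Suc)
    have "(a * q powi (i - 1) - 1) * psi_coeff (a / q) (i - 1 + 1) = psi_coeff (a / q) (i + 1)"
      using psi_coeff_Suc[OF a', of "i - 1 + 1"] q_nz by (simp add: power_int_diff)
    also have "\<dots> = (a * q powi (i - 1) - 1) * ((a / q - 1) * psi_coeff a (i - 1))"
      unfolding step2 using psi_coeff_Suc[OF a(2), of "i - 1"] by simp
    finally show ?case using nz by simp
  qed
qed

text \<open>The number \<open>psi_prod (a / q) 1\<close> is computed twice: by the recurrence in N,
  and termwise by the shift of the parameter.\<close>

lemma psi_prod_shift:
  assumes a: "a \<noteq> 0" "\<And>k. a \<noteq> q ^ Suc k"
  shows   "psi_prod (a / q) 0 = (1 - q / a) * psi_prod a 0"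
proof -
  have a': "a / q \<noteq> q ^ Suc k" for k
    using a(2)[of "Suc k"] q_nz by (auto simp: field_simps)
  have "a / q * psi_prod (a / q) 0 = psi_prod (a / q) (0 + 1)"
    using a q_nz by (subst psi_prod_rec[OF _ a']) auto
  also have "\<dots> = (\<Sum>\<^sub>\<infinity>k. (a / q - 1) * (euler_coeff q k * psi_coeff a (0 - int k)))"
    unfolding psi_prod_def
  proof (rule infsum_cong)
    fix k
    show "euler_coeff q k * psi_coeff (a / q) (0 + 1 - int k) =
            (a / q - 1) * (euler_coeff q k * psi_coeff a (0 - int k))"
      using psi_coeff_shift[OF a, of "- int k"] by (simp add: add.commute)
  qed
  also have "\<dots> = (a / q - 1) * psi_prod a 0"
    unfolding psi_prod_def by (rule infsum_cmult_right')
  finally show ?thesis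
    using a q_nz by (simp add: field_simps)
qed

text \<open>The coefficient at -k is a product of k factors q^j / (a - q^j), each at most 1 / (|a| -
  1). One of them is kept to provide the decay; the others are bounded by 1, which is where |a|
  \<ge> 2 enters.\<close>

lemma psi_prod_0_near_1:
  assumes a: "\<And>k. a \<noteq> q ^ Suc k" and na: "norm a \<ge> 2"
  shows   "norm (psi_prod a 0 - 1) \<le> (\<Sum>k. norm (euler_coeff q (Suc k))) / (norm a - 1)"
proof -
  have a0: "a \<noteq> 0" using na by auto
  have ratio: "norm (q ^ Suc n / (a - q ^ Suc n)) \<le> 1 / (norm a - 1)" for n
  proof -
    have 1: "norm (q ^ Suc n) \<le> 1"
      using norm_q unfolding norm_power by (intro power_le_one) auto
    moreover have "norm a - norm (q ^ Suc n) \<le> norm (a - q ^ Suc n)"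
      by (rule norm_triangle_ineq2)
    ultimately show ?thesis
      unfolding norm_divide using na by (intro frac_le) linarith+
  qed
  have inv: "1 / (norm a - 1) \<le> 1" using na by simp
  have le1: "norm (psi_coeff a (- int n)) \<le> 1" for n
  proof (induction n)
    case (Suc n)
    show ?case
      unfolding psi_coeff_minus_Suc[OF a] norm_mult
      using mult_mono[OF order.trans[OF ratio[of n] inv] Suc] by simp
  qed auto
  have bound: "norm (psi_coeff a (- int (Suc n))) \<le> 1 / (norm a - 1)" for n
    unfolding psi_coeff_minus_Suc[OF a] norm_mult
    using mult_mono[OF ratio[of n] le1[of n]] na by simp
  have "(\<lambda>k. euler_coeff q (Suc k) * psi_coeff a (- int (Suc k))) sums (psi_prod a 0 - 1)"
    using psi_prod_sums[OF a0 a, of 0] by (subst sums_Suc_iff) simp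
  hence "norm (psi_prod a 0 - 1) = norm (\<Sum>k. euler_coeff q (Suc k) * psi_coeff a (- int (Suc k)))"
    by (simp add: sums_iff)
  also have sm: "summable (\<lambda>k. norm (euler_coeff q (Suc k)))"
    using summable_qprod[of 1] by (subst summable_Suc_iff) simp
  have "norm (\<Sum>k. euler_coeff q (Suc k) * psi_coeff a (- int (Suc k))) \<le>
          (\<Sum>k. norm (euler_coeff q (Suc k)) * (1 / (norm a - 1)))"
  proof (rule norm_suminf_le)
    show "norm (euler_coeff q (Suc k) * psi_coeff a (- int (Suc k))) \<le>
            norm (euler_coeff q (Suc k)) * (1 / (norm a - 1))" for k
      unfolding norm_mult by (intro mult_left_mono bound) auto
    show "summable (\<lambda>k. norm (euler_coeff q (Suc k)) * (1 / (norm a - 1)))"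
      by (intro summable_mult2 sm)
  qed
  also have "\<dots> = (\<Sum>k. norm (euler_coeff q (Suc k))) * (1 / (norm a - 1))"
    by (rule suminf_mult2[OF sm, symmetric])
  finally show ?thesis by simp
qed

text \<open>
  The functional equation in \<open>a\<close> moves \<open>a\<close> to infinity, where only the leading term survives.
\<close>

lemma psi_prod_0:
  assumes a: "a \<noteq> 0" "\<And>k. a \<noteq> q ^ Suc k"
  shows   "psi_prod a 0 = 1 / qprod q (- q / a)"
proof -
  have a': "a / q ^ n \<noteq> q ^ Suc k" for n k
    using a(2)[of "k + n"] q_nz by (auto simp: field_simps power_add)
  have iter: "psi_prod (a / q ^ n) 0 = (\<Prod>k<n. 1 + (- q / a) * q ^ k) * psi_prod a 0" for n
  proof (induction n)
    case (Suc n)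
    have "psi_prod (a / q ^ Suc n) 0 = (1 - q / (a / q ^ n)) * psi_prod (a / q ^ n) 0"
      using psi_prod_shift[OF _ a', of n] a q_nz by (simp add: field_simps)
    thus ?case using Suc a by (simp add: field_simps)
  qed auto
  define S where "S = (\<Sum>k. norm (euler_coeff q (Suc k)))"
  have lim_inf: "filterlim (\<lambda>n. norm (a / q ^ n)) at_top sequentially"
  proof -
    have "filterlim (\<lambda>n. (1 / norm q) ^ n) at_top sequentially"
      using norm_q q_nz filterlim_at_infinity_imp_norm_at_top[OF
              filterlim_realpow_sequentially_gt1[of "1 / norm q"]] by simp
    hence "filterlim (\<lambda>n. norm a * (1 / norm q) ^ n) at_top sequentially"
      using a by (intro filterlim_tendsto_pos_mult_at_top[OF tendsto_const]) auto
    thus ?thesis by (simp add: norm_divide norm_power power_divide)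
  qed
  have "(\<lambda>n. S / (norm (a / q ^ n) - 1)) \<longlonglongrightarrow> 0"
    by (intro real_tendsto_divide_at_top[OF tendsto_const]
          filterlim_at_top_mono[OF lim_inf] filterlim_tendsto_add_at_top[OF tendsto_const[of "-1"] lim_inf, simplified])
  moreover have "eventually (\<lambda>n. norm (psi_prod (a / q ^ n) 0 - 1) \<le> S / (norm (a / q ^ n) - 1)) sequentially"
    using filterlim_at_top[THEN iffD1, OF lim_inf, rule_format, of 2]
    by eventually_elim (unfold S_def, rule psi_prod_0_near_1[OF a'])
  ultimately have "(\<lambda>n. psi_prod (a / q ^ n) 0 - 1) \<longlonglongrightarrow> 0"
    by (rule Lim_null_comparison[rotated])
  hence "(\<lambda>n. psi_prod (a / q ^ n) 0) \<longlonglongrightarrow> 1"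
    by (simp add: LIM_zero_iff)
  moreover have "(\<lambda>n. psi_prod (a / q ^ n) 0) \<longlonglongrightarrow> qprod q (- q / a) * psi_prod a 0"
    unfolding iter by (intro tendsto_intros qprod_LIMSEQ)
  ultimately have "qprod q (- q / a) * psi_prod a 0 = 1"
    using LIMSEQ_unique by blast
  thus ?thesis by (intro eq_divide_imp) (auto simp: mult.commute)
qed

text \<open>In the denominator stand (q/a;q)_inf and (-\<xi>;q)_inf. The triple product for
  theta(\<xi>) turns this into the usual form with theta(a \<xi>) / theta(\<xi>) and the factor
  (-q/\<xi>;q)_inf.\<close>

lemma ramanujan_psi_sum:
  assumes a: "a \<noteq> 0" "\<And>k. a \<noteq> q ^ Suc k" and \<xi>: "\<xi> \<noteq> 0" "norm \<xi> < 1"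
  shows   "((\<lambda>n. psi_coeff a n * \<xi> powi n) has_sum
             (theta q (a * \<xi>) / (qprod q (- q / a) * qprod q \<xi>))) UNIV"
proof -
  have nz: "qprod q \<xi> \<noteq> 0"
    using \<xi>(2) by (rule qprod_nonzero_ball)
  have "(\<Sum>\<^sub>\<infinity>n. psi_coeff a n * \<xi> powi n) * qprod q \<xi> = (\<Sum>\<^sub>\<infinity>N. psi_prod a N * \<xi> powi N)"
    using psi_prod_has_sum(1)[OF a \<xi>] infsumI by metis
  also have "\<dots> = (\<Sum>\<^sub>\<infinity>N. psi_prod a 0 * (q powi (N * (N - 1) div 2) * (a * \<xi>) powi N))"
    by (subst psi_prod_eq[OF a]) (simp add: power_int_mult_distrib mult_ac)
  also have "\<dots> = psi_prod a 0 * theta q (a * \<xi>)"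
    unfolding theta_def by (rule infsum_cmult_right')
  finally have "(\<Sum>\<^sub>\<infinity>n. psi_coeff a n * \<xi> powi n) = psi_prod a 0 * theta q (a * \<xi>) / qprod q \<xi>"
    using nz by (simp add: eq_divide_eq)
  hence "(\<Sum>\<^sub>\<infinity>n. psi_coeff a n * \<xi> powi n) = theta q (a * \<xi>) / (qprod q (- q / a) * qprod q \<xi>)"
    unfolding psi_prod_0[OF a] by simp
  moreover have "(\<lambda>n. psi_coeff a n * \<xi> powi n) summable_on UNIV"
    using psi_abs_summable[OF a \<xi>] by (rule abs_summable_summable)
  ultimately show ?thesis
    using has_sum_infsum by metis
qed

end

section \<open>Theta function and Borel-Laplace transform\<close>

lemma triangle_add:
  "(n + m) * (n + m - 1) div 2 = n * (n - 1) div 2 + m * (m - 1) div 2 + n * (m :: int)"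
proof -
  have "even (n * (n - 1))" "even (m * (m - 1))" by auto
  then obtain i j where ij: "n * (n - 1) = 2 * i" "m * (m - 1) = 2 * j"
    by (meson evenE)
  have "(n + m) * (n + m - 1) = n * (n - 1) + m * (m - 1) + 2 * (n * m)"
    by (simp add: algebra_simps)
  thus ?thesis by (simp add: ij)
qed

context nome
begin

text \<open>By \<open>triangle_add\<close> the shift of the argument amounts to reindexing the
  bilateral sum by m and pulling out a constant; both operations are valid for \<open>infsum\<close>
  whether or not it converges.\<close>

lemma theta_shift:
  assumes "z \<noteq> 0"
  shows   "theta q (z * q powi m) = theta q z / (q powi (m * (m - 1) div 2) * z powi m)"
proof -
  define c where "c = q powi (m * (m - 1) div 2) * z powi m"
  have c: "c \<noteq> 0" using assms q_nz by (simp add: c_def)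
  have "q powi (n * (n - 1) div 2) * (z * q powi m) powi n =
          (1 / c) * (q powi ((n + m) * (n + m - 1) div 2) * z powi (n + m))" for n
    unfolding triangle_add c_def using assms q_nz
    by (simp add: power_int_add power_int_mult_distrib power_int_mult mult.commute)
  hence "theta q (z * q powi m) =
           (\<Sum>\<^sub>\<infinity>n. (1 / c) * (q powi ((n + m) * (n + m - 1) div 2) * z powi (n + m)))"
    unfolding theta_def by simp
  also have "\<dots> = (1 / c) * (\<Sum>\<^sub>\<infinity>n. q powi ((n + m) * (n + m - 1) div 2) * z powi (n + m))"
    by (rule infsum_cmult_right')
  also have "(\<Sum>\<^sub>\<infinity>n. q powi ((n + m) * (n + m - 1) div 2) * z powi (n + m)) = theta q z"
    unfolding theta_def
    by (rule infsum_reindex_bij_witness[of _ "\<lambda>n. n - m" "\<lambda>n. n + m"]) auto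
  finally show ?thesis by (simp add: c_def)
qed

section \<open>The Jacobi triple product\<close>

text \<open>This is Ramanujan's sum at a = 1: the coefficients of positive index vanish, and the
  remaining half is Euler's series at q / z.\<close>

lemma jacobi_triple_product_disc:
  assumes z: "z \<noteq> 0" "norm z < 1"
  shows   "theta q z = qprod q (- q) * qprod q z * qprod q (q / z)"
proof -
  have one: "1 \<noteq> q ^ Suc k" for k
    using q_power_neq_1[of k] by metis
  have neg: "psi_coeff 1 (- int n) = euler_coeff q n * q ^ n" for n
    by (induction n) (simp_all add: psi_coeff_minus_Suc[OF one] euler_coeff_Suc del: of_nat_Suc)
  have pos: "psi_coeff 1 (int (Suc n)) = 0" for n
  proof (induction n)
    case 0
    show ?case using psi_coeff_Suc[OF one, of 0] by simp
  next
    case (Suc n)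
    thus ?case using psi_coeff_Suc[OF one, of "int (Suc n)"] by (simp add: add.commute)
  qed
  have neg': "psi_coeff 1 (- int n) * z powi (- int n) = euler_coeff q n * (q / z) ^ n" for n
    by (simp add: neg power_int_minus power_mult_distrib power_inverse divide_inverse)
  have "((\<lambda>n. euler_coeff q n * (q / z) ^ n) has_sum qprod q (q / z)) UNIV"
    by (rule qprod_has_sum)
  also have "?this \<longleftrightarrow> ((\<lambda>n. psi_coeff 1 n * z powi n) has_sum qprod q (q / z)) (range (\<lambda>n. - int n))"
    by (subst has_sum_reindex) (simp_all add: inj_on_def o_def neg')
  also have "\<dots> \<longleftrightarrow> ((\<lambda>n. psi_coeff 1 n * z powi n) has_sum qprod q (q / z)) UNIV"
  proof (rule has_sum_cong_neutral)
    fix n :: int assume "n \<in> UNIV - range (\<lambda>n. - int n)"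
    moreover have "n = - int (nat (- n))" if "n \<le> 0"
      using that by simp
    ultimately have "n > 0"
      by (metis DiffD2 rangeI not_le)
    then obtain m where "n = int (Suc m)"
      by (metis pos_int_cases gr0_implies_Suc)
    thus "psi_coeff 1 n * z powi n = 0" by (simp only: pos mult_zero_left)
  qed auto
  finally have "qprod q (q / z) = theta q z / (qprod q (- q) * qprod q z)"
    using ramanujan_psi_sum[OF _ one z] has_sum_unique by fastforce
  moreover have "qprod q z \<noteq> 0"
    using z(2) by (rule qprod_nonzero_ball)
  ultimately show ?thesis
    using qprod_minus_q_nz by (simp add: field_simps)
qed

text \<open>Both sides have the same quasi-periodicity under w to q w, so the identity spreads
  outwards from the unit disc, into which some z q^n falls.\<close>

theorem jacobi_triple_product:
  assumes z: "z \<noteq> 0"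
  shows   "theta q z = qprod q (- q) * qprod q z * qprod q (q / z)"
proof -
  have step: "theta q w = qprod q (- q) * qprod q w * qprod q (q / w)"
    if w: "w \<noteq> 0" and eq: "theta q (w * q) = qprod q (- q) * qprod q (w * q) * qprod q (q / (w * q))" for w
  proof -
    have 1: "qprod q (1 / w) = (1 + 1 / w) * qprod q (q / w)"
      using qprod_rec[of "1 / w"] by simp
    have 2: "qprod q w = (1 + w) * qprod q (w * q)"
      using qprod_rec[of w] by (simp add: mult.commute)
    have "theta q w = w * theta q (w * q)"
      using theta_shift[OF w, of 1] w by simp
    also have "\<dots> = w * (qprod q (- q) * qprod q (w * q) * qprod q (1 / w))"
      using eq q_nz by simp
    also have "\<dots> = qprod q (- q) * qprod q w * qprod q (q / w)"
      unfolding 1 2 using w by (simp add: field_simps)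
    finally show ?thesis .
  qed
  have "(\<lambda>n. norm (z * q ^ n)) \<longlonglongrightarrow> norm (z * 0)"
    by (intro tendsto_intros q_power_tendsto_0)
  hence "eventually (\<lambda>n. norm (z * q ^ n) < 1) sequentially"
    by (rule order_tendstoD) auto
  then obtain n where n: "norm (z * q ^ n) < 1"
    by (auto simp: eventually_at_top_linorder)
  show ?thesis using z n
  proof (induction n arbitrary: z)
    case 0
    thus ?case by (intro jacobi_triple_product_disc) auto
  next
    case (Suc n)
    show ?case
      by (rule step[OF _ Suc.IH]) (use Suc.prems q_nz in \<open>auto simp: mult_ac\<close>)
  qed
qed

section \<open>The continuation of the Borel transform\<close>

text \<open>The choice operator demands both existence and uniqueness. Ramanujan's sum with its
  singularities removed is a witness; any other choice agrees with it near 0, hence off a sparse set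
  of the connected punctured plane, and by continuity at each point where the formula is
  analytic.\<close>

lemma laurent_continuation_psi:
  assumes a: "a \<noteq> 0" "\<And>k. a \<noteq> q ^ Suc k" and \<xi>: "\<xi> \<noteq> 0" "qprod q \<xi> \<noteq> 0"
  shows   "laurent_continuation (psi_coeff a) \<xi> = theta q (a * \<xi>) / (qprod q (- q / a) * qprod q \<xi>)"
proof -
  define F where "F = (\<lambda>w. theta q (a * w) / (qprod q (- q / a) * qprod q w))"
  \<comment> \<open>\<open>G\<close> is the triple product for theta(a w), from which holomorphy is
    immediate.\<close>
  define G where "G = (\<lambda>w. qprod q (- q) * qprod q (a * w) * qprod q (q / (a * w)))"
  have qp: "(\<lambda>w. qprod q (g w)) holomorphic_on A" if "g holomorphic_on A" for g A
    using holomorphic_on_compose[OF that holomorphic_qprod] by (simp add: o_def)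
  have G: "G holomorphic_on (- {0})"
    unfolding G_def using a by (intro holomorphic_intros qp) auto
  have FG: "F w = G w / (qprod q (- q / a) * qprod q w)" if "w \<noteq> 0" for w
    using that a by (simp add: F_def G_def jacobi_triple_product)
  have hol: "F holomorphic_on {w. w \<noteq> 0 \<and> qprod q w \<noteq> 0}"
  proof (cases "qprod q (- q / a) = 0")
    case True
    thus ?thesis by (simp add: F_def)
  next
    case False
    have "(\<lambda>w. G w / (qprod q (- q / a) * qprod q w)) holomorphic_on {w. w \<noteq> 0 \<and> qprod q w \<noteq> 0}"
      using False by (intro holomorphic_intros qp holomorphic_on_subset[OF G]) auto
    thus ?thesis
      by (rule holomorphic_transform) (auto simp: FG)
  qed
  have op: "open {w. w \<noteq> 0 \<and> qprod q w \<noteq> 0}"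
  proof -
    have "continuous_on UNIV (qprod q)"
      by (intro holomorphic_on_imp_continuous_on holomorphic_qprod)
    hence "open (UNIV \<inter> qprod q -` (- {0}))"
      by (intro continuous_open_preimage) auto
    hence "open (- {0} \<inter> (UNIV \<inter> qprod q -` (- {0})))"
      by (intro open_Int) auto
    also have "- {0} \<inter> (UNIV \<inter> qprod q -` (- {0})) = {w. w \<noteq> 0 \<and> qprod q w \<noteq> 0}"
      by auto
    finally show ?thesis .
  qed
  have ana: "F analytic_on {w. w \<noteq> 0 \<and> qprod q w \<noteq> 0}"
    using op hol by (simp add: analytic_on_open)
  have "open (- {0 :: complex})"
    by (simp add: open_Compl)
  hence "G meromorphic_on (- {0})" "qprod q meromorphic_on (- {0})"
    using G holomorphic_qprod[of "- {0}"]
    by (auto intro!: analytic_on_imp_meromorphic_on simp: analytic_on_open)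
  hence "(\<lambda>w. G w / (qprod q (- q / a) * qprod q w)) meromorphic_on (- {0})"
    by (intro meromorphic_intros)
  also have "?this \<longleftrightarrow> F meromorphic_on (- {0})"
  proof (rule meromorphic_on_cong)
    fix z :: complex assume "z \<in> - {0}"
    hence "eventually (\<lambda>w. w \<in> - {0} - {z}) (at z)"
      by (intro eventually_at_in_open) (auto simp: open_Compl)
    thus "eventually (\<lambda>w. G w / (qprod q (- q / a) * qprod q w) = F w) (at z)"
      by eventually_elim (auto simp: FG)
  qed auto
  finally have mero: "F meromorphic_on (- {0})" .
  have small: "eventually (\<lambda>w::complex. w \<noteq> 0 \<and> norm w < 1) (at 0)"
    unfolding eventually_at by (intro exI[of _ 1]) auto
  define P where "P = (\<lambda>\<phi>. \<phi> nicely_meromorphic_on (- {0}) \<and>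
        (\<forall>\<^sub>F \<xi> in at 0. ((\<lambda>n. psi_coeff a n * \<xi> powi n) has_sum \<phi> \<xi>) UNIV))"
  define \<phi> where "\<phi> = laurent_continuation (psi_coeff a)"
  have "P (remove_sings F)"
    unfolding P_def
  proof
    show "remove_sings F nicely_meromorphic_on - {0}"
      using mero by (rule remove_sings_nicely_meromorphic)
    show "\<forall>\<^sub>F \<xi> in at 0. ((\<lambda>n. psi_coeff a n * \<xi> powi n) has_sum remove_sings F \<xi>) UNIV"
      using small
    proof eventually_elim
      case (elim w)
      hence "F analytic_on {w}"
        using qprod_nonzero_ball by (intro analytic_on_subset[OF ana]) auto
      thus ?case
        using ramanujan_psi_sum[OF a, of w] elim by (simp add: F_def)
    qed
  qed
  hence "P \<phi>"
    using someI[of P "remove_sings F"] by (simp add: \<phi>_def laurent_continuation_def P_def)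
  hence nice: "\<phi> nicely_meromorphic_on (- {0})"
    and sum: "\<forall>\<^sub>F w in at 0. ((\<lambda>n. psi_coeff a n * w powi n) has_sum \<phi> w) UNIV"
    by (auto simp: P_def)
  from sum small have "\<forall>\<^sub>F w in at 0. \<phi> w = F w"
  proof eventually_elim
    case (elim w)
    thus ?case
      using ramanujan_psi_sum[OF a, of w] has_sum_unique unfolding F_def by blast
  qed
  then obtain r where r: "r > 0" "\<And>w. w \<noteq> 0 \<Longrightarrow> norm w < r \<Longrightarrow> \<phi> w = F w"
    by (auto simp: eventually_at)
  define z0 where "z0 = complex_of_real (r / 2)"
  have z0: "z0 \<noteq> 0" "norm z0 < r" using r by (auto simp: z0_def)
  have "(\<lambda>w. \<phi> w - F w) meromorphic_on (- {0})"
    using nice mero by (intro meromorphic_intros) (auto simp: nicely_meromorphic_on_def)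
  \<comment> \<open>The second alternative fails at \<open>z0\<close>, around which the two
    functions coincide on an open set.\<close>
  hence "(\<forall>\<^sub>\<approx>w\<in>-{0}. \<phi> w - F w = 0) \<or> (\<forall>\<^sub>\<approx>w\<in>-{0}. \<phi> w - F w \<noteq> 0)"
    by (intro meromorphic_imp_constant_or_avoid) (auto intro: connected_punctured_universe)
  moreover have "\<not> (\<forall>\<^sub>\<approx>w\<in>-{0}. \<phi> w - F w \<noteq> 0)"
  proof
    assume "\<forall>\<^sub>\<approx>w\<in>-{0}. \<phi> w - F w \<noteq> 0"
    hence "eventually (\<lambda>w. \<phi> w - F w \<noteq> 0) (at z0)"
      using z0 by (subst (asm) eventually_cosparse_open_eq) auto
    moreover have "eventually (\<lambda>w. w \<in> ball 0 r - {0}) (at z0)"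
      using z0 by (intro eventually_at_in_open') auto
    ultimately have "eventually (\<lambda>_. False) (at z0)"
      by eventually_elim (use r in auto)
    thus False by simp
  qed
  ultimately have "eventually (\<lambda>w. \<phi> w - F w = 0) (at \<xi>)"
    using \<xi> by (subst (asm) (1) eventually_cosparse_open_eq) auto
  hence ev: "eventually (\<lambda>w. F w = \<phi> w) (at \<xi>)"
    by eventually_elim auto
  have "F \<midarrow>\<xi>\<rightarrow> F \<xi>"
    using \<xi> by (intro isContD analytic_at_imp_isCont analytic_on_subset[OF ana]) auto
  hence lim: "\<phi> \<midarrow>\<xi>\<rightarrow> F \<xi>"
    using tendsto_cong[OF ev] by blast
  \<comment> \<open>A nicely meromorphic function takes its limit as value except at poles, where it
    is 0 by convention; the finite limit rules out a pole.\<close>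
  have "is_pole \<phi> \<xi> \<and> \<phi> \<xi> = 0 \<or> \<phi> \<midarrow>\<xi>\<rightarrow> \<phi> \<xi>"
    using nice \<xi> by (auto simp: nicely_meromorphic_on_def)
  moreover have "\<not> is_pole \<phi> \<xi>"
    using lim not_tendsto_and_filterlim_at_infinity[of "at \<xi>" \<phi>] unfolding is_pole_def by auto
  ultimately have "\<phi> \<xi> = F \<xi>"
    using lim LIM_unique by blast
  thus ?thesis
    by (simp add: \<phi>_def F_def)
qed

section \<open>The closed form of the Borel-Laplace transform\<close>

text \<open>This turns the denominators \<open>qprod q (l * q powi n)\<close> along the spiral into
  shifted factorials with parameter - l, that is, into coefficients of a second Ramanujan
  sum.\<close>

lemma qprod_shift_qpoch:
  assumes l: "\<And>k. - l \<noteq> q ^ Suc k"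
  shows   "qprod q l = qpoch (- l) q n * qprod q (l * q powi n)"
proof -
  have rec: "qpoch (- l) q (m + 1) * qprod q (l * q powi (m + 1)) =
               qpoch (- l) q m * qprod q (l * q powi m)" for m
    unfolding qpoch_Suc[OF q_nz l] using qprod_rec[of "l * q powi m"] q_nz
    by (simp add: power_int_add mult_ac)
  show ?thesis
  proof (induction n rule: int_induct[where k = 0])
    case base
    thus ?case by (simp add: qpoch_def)
  next
    case (step1 i)
    thus ?case using rec[of i] by simp
  next
    case (step2 i)
    thus ?case using rec[of "i - 1"] by simp
  qed
qed

text \<open>The powers q^(n(n-1)/2) from the two theta functions cancel, and their monomials leave
  (1 / (a x))^n. The bound on 1 / (a x) is the convergence condition of the remaining bilateral
  sum.\<close>

lemma qBorelLaplace_psi10: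
  assumes a: "a \<noteq> 0" "\<And>k. a \<noteq> q ^ Suc k"
    and l: "l \<noteq> 0" "\<And>n::int. 1 + l * q powi n \<noteq> 0"
    and x: "x \<noteq> 0" "norm (1 / (a * x)) < 1"
  shows "qBorelLaplace q l (psi10 a q) x =
           theta q (a * l) * theta q (l / (a * x)) /
           (theta q (l / x) * qprod q l * qprod q (q / l) * qprod q (- q / a) * qprod q (- 1 / (a * x)))"
proof -
  have l': "- l \<noteq> q ^ Suc k" for k
  proof
    assume "- l = q ^ Suc k"
    hence "l = - (q ^ Suc k)"
      by (metis minus_minus)
    hence "1 + l * q powi (- int (Suc k)) = 0"
      using q_nz by (simp add: power_int_minus field_simps del: of_nat_Suc power_Suc)
    with l(2) show False by blast
  qed
  have nz: "qprod q (l * q powi n) \<noteq> 0" for n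
  proof (rule qprod_nonzero)
    fix k
    show "1 + l * q powi n * q ^ k \<noteq> 0"
      using l(2)[of "n + int k"] q_nz by (simp add: power_int_add mult_ac)
  qed
  define c where "c = theta q (a * l) / (theta q (l / x) * qprod q (- q / a) * qprod q l)"
  \<comment> \<open>The minus sign absorbs the (-1)^n contained in \<open>psi_coeff\<close>.\<close>
  define \<xi> where "\<xi> = - 1 / (a * x)"
  have \<xi>: "\<xi> \<noteq> 0" "norm \<xi> < 1"
    using a x by (auto simp: \<xi>_def norm_divide)
  have "laurent_continuation (psi_coeff a) (l * q powi n) / theta q (l * q powi n / x) =
          c * (psi_coeff (- l) n * \<xi> powi n)" for n
  proof -
    have "laurent_continuation (psi_coeff a) (l * q powi n) =
            theta q (a * l * q powi n) / (qprod q (- q / a) * qprod q (l * q powi n))"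
      using nz[of n] l q_nz laurent_continuation_psi[OF a, of "l * q powi n"] by (simp add: mult_ac)
    also have "theta q (a * l * q powi n) =
                 theta q (a * l) / (q powi (n * (n - 1) div 2) * (a * l) powi n)"
      using a l by (intro theta_shift) auto
    finally have 1: "laurent_continuation (psi_coeff a) (l * q powi n) =
        theta q (a * l) / (q powi (n * (n - 1) div 2) * (a * l) powi n) / 
         (qprod q (- q / a) * qprod q (l * q powi n))" .
    have 2: "theta q (l * q powi n / x) = theta q (l / x) / (q powi (n * (n - 1) div 2) * (l / x) powi n)"
      using theta_shift[of "l / x" n] l x by simp
    have 3: "qprod q l = qpoch (- l) q n * qprod q (l * q powi n)"
      by (rule qprod_shift_qpoch[OF l'])
    have nz': "qprod q l \<noteq> 0" using nz[of 0] by simp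
    have 4: "1 / qprod q (l * q powi n) = qpoch (- l) q n / qprod q l"
      using nz[of n] nz' 3 by (simp add: field_simps)
    have 5: "psi_coeff (- l) n * \<xi> powi n = qpoch (- l) q n * (1 / (a * x)) powi n"
      by (simp add: psi_coeff_eq \<xi>_def flip: power_int_mult_distrib)
    have "laurent_continuation (psi_coeff a) (l * q powi n) / theta q (l * q powi n / x) =
            theta q (a * l) / theta q (l / x) / qprod q (- q / a) * (1 / qprod q (l * q powi n)) * 
            ((l / x) powi n / (a * l) powi n)"
      unfolding 1 2 using q_nz by simp
    also have "(l / x) powi n / (a * l) powi n = (1 / (a * x)) powi n"
      using l by (simp add: field_simps flip: power_int_divide_distrib)
    finally show ?thesis
      unfolding 4 5 by (simp add: c_def)
  qed
  hence "qBorelLaplace q l (psi10 a q) x = (\<Sum>\<^sub>\<infinity>n. c * (psi_coeff (- l) n * \<xi> powi n))"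
    by (simp add: qBorelLaplace_def qLaplace_def)
  also have "\<dots> = c * (\<Sum>\<^sub>\<infinity>n. psi_coeff (- l) n * \<xi> powi n)"
    by (rule infsum_cmult_right')
  also have "(\<Sum>\<^sub>\<infinity>n. psi_coeff (- l) n * \<xi> powi n) = 
               theta q (- l * \<xi>) / (qprod q (- q / (- l)) * qprod q \<xi>)"
    using l by (intro infsumI ramanujan_psi_sum l' \<xi>) auto
  finally show ?thesis
    by (simp add: c_def \<xi>_def mult_ac)
qed

end

section \<open>Ratios of infinite products as \<open>q\<close> tends to 1\<close>

lemma norm_exp_minus_one_le:
  fixes w :: complex
  shows "norm (exp w - 1) \<le> exp (norm w) - 1"
proof -
  have 1: "(\<lambda>n. w ^ Suc n /\<^sub>R fact (Suc n)) sums (exp w - 1)"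
    using exp_converges[of w] by (subst sums_Suc_iff) simp
  have 2: "(\<lambda>n. norm w ^ Suc n /\<^sub>R fact (Suc n)) sums (exp (norm w) - 1)"
    using exp_converges[of "norm w"] by (subst sums_Suc_iff) simp
  have "norm (\<Sum>n. w ^ Suc n /\<^sub>R fact (Suc n)) \<le> (\<Sum>n. norm w ^ Suc n /\<^sub>R fact (Suc n))"
    by (rule norm_suminf_le) (use 2 in \<open>auto simp: norm_power norm_mult divide_inverse sums_iff simp del: fact_Suc\<close>)
  thus ?thesis using 1 2 by (simp add: sums_iff)
qed

text \<open>With g(v) = Ln (1 + z exp (- v)), the linear parts of g(t \<alpha>) - g(0) and of
  \<alpha> (g(t) - g(0)) are both g'(0) t \<alpha> and cancel. \<open>B\<close> bounds g''; the
  condition 1 \<le> M puts t as well as t \<alpha> into the disc. Each of the two Taylor remainders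
  is at most B (M t)^2.\<close>

lemma Ln_one_plus_exp_second_order:
  fixes z \<alpha> :: complex
  assumes t: "t > 0" and M: "1 \<le> M" "norm \<alpha> \<le> M"
  assumes *: "\<And>v. norm v \<le> M * t \<Longrightarrow> 1 + z * exp (- v) \<notin> \<real>\<^sub>\<le>\<^sub>0"
             "\<And>v. norm v \<le> M * t \<Longrightarrow> norm (z * exp (- v) / (1 + z * exp (- v))\<^sup>2) \<le> B"
  shows "norm (Ln (1 + z * exp (- (of_real t * \<alpha>))) - Ln (1 + z)
                 - \<alpha> * (Ln (1 + z * exp (- of_real t)) - Ln (1 + z))) \<le> 2 * M\<^sup>2 * t\<^sup>2 * B"
proof -
  define E where "E = (\<lambda>(i::nat) v. if i = 0 then Ln (1 + z * exp (- v))
                        else if i = 1 then - (z * exp (- v) / (1 + z * exp (- v)))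
                        else z * exp (- v) / (1 + z * exp (- v))\<^sup>2)"
  let ?S = "cball 0 (M * t) :: complex set"
  have deriv: "(E i has_field_derivative E (Suc i) v) (at v within ?S)" if "v \<in> ?S" "i \<le> 1" for i v
  proof -
    have nz: "1 + z * exp (- v) \<notin> \<real>\<^sub>\<le>\<^sub>0" using that by (intro *) auto
    hence nz': "1 + z * exp (- v) \<noteq> 0" by auto
    from that consider "i = 0" | "i = 1" by linarith
    thus ?thesis
    proof cases
      case 1
      have "((\<lambda>v. Ln (1 + z * exp (- v))) has_field_derivative - (z * exp (- v) / (1 + z * exp (- v)))) (at v within ?S)"
        using nz nz' by (auto intro!: derivative_eq_intros simp: field_simps)
      thus ?thesis by (simp add: 1 E_def)
    next
      case 2
      have "((\<lambda>v. - (z * exp (- v) / (1 + z * exp (- v)))) has_field_derivative z * exp (- v) / (1 + z * exp (- v))\<^sup>2) (at v within ?S)"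
        using nz' by (auto intro!: derivative_eq_intros simp: power2_eq_square divide_simps) (simp add: algebra_simps)
      thus ?thesis by (simp add: 2 E_def)
    qed
  qed
  have B: "norm (E (Suc 1) v) \<le> B" if "v \<in> ?S" for v
    using that *(2)[of v] by (simp add: E_def)
  have B0: "B \<ge> 0"
    using order.trans[OF norm_ge_zero *(2)[of 0]] M t by simp
  have zero: "(0::complex) \<in> ?S" using M t by simp
  have *: "norm (E 0 v - E 0 0 - E 1 0 * v) \<le> B * norm v ^ 2" if "v \<in> ?S" for v
    using complex_Taylor[OF convex_cball deriv B zero that] by (simp add: algebra_simps numeral_2_eq_2)
  define u where "u = of_real t * \<alpha>"
  have u: "norm u \<le> M * t"
    using M t by (simp add: u_def norm_mult mult.commute mult_left_mono)
  have 1: "norm (E 0 u - E 0 0 - E 1 0 * u) \<le> B * (M * t)\<^sup>2"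
    using *[of u] u B0 by (intro order.trans[OF *]) (auto intro!: mult_left_mono power_mono)
  have t': "norm (of_real t :: complex) \<le> M * t"
    using M t by simp
  have 2: "norm (E 0 (of_real t) - E 0 0 - E 1 0 * of_real t) \<le> B * t\<^sup>2"
    using *[of "of_real t"] t' t by simp
  have "norm (\<alpha> * (E 0 (of_real t) - E 0 0 - E 1 0 * of_real t)) \<le> M * (B * t\<^sup>2)"
    unfolding norm_mult using M B0 by (intro mult_mono 2) auto
  also have "M * (B * t\<^sup>2) \<le> B * (M * t)\<^sup>2"
  proof -
    have "M * (B * t\<^sup>2) \<le> (M * M) * (B * t\<^sup>2)"
      using mult_left_mono[of 1 M M] M B0 by (intro mult_right_mono) auto
    thus ?thesis by (simp add: power2_eq_square mult_ac)
  qed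
  finally have 3: "norm (\<alpha> * (E 0 (of_real t) - E 0 0 - E 1 0 * of_real t)) \<le> B * (M * t)\<^sup>2" .
  have "Ln (1 + z * exp (- (of_real t * \<alpha>))) - Ln (1 + z) - \<alpha> * (Ln (1 + z * exp (- of_real t)) - Ln (1 + z)) =
          (E 0 u - E 0 0 - E 1 0 * u) - \<alpha> * (E 0 (of_real t) - E 0 0 - E 1 0 * of_real t)"
    by (simp add: E_def u_def algebra_simps)
  also have "norm \<dots> \<le> B * (M * t)\<^sup>2 + B * (M * t)\<^sup>2"
    by (rule order.trans[OF norm_triangle_ineq4 add_mono[OF 1 3]])
  finally show ?thesis by (simp add: power_mult_distrib mult_ac)
qed

lemma nome_exp: "t > 0 \<Longrightarrow> nome (of_real (exp (- t)))"
  by unfold_locales auto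

text \<open>The second-order comparison is applied to each factor, with z q^k in place of z. Since
  multiplication by exp (- t) leads from z q^k to z q^(k+1), the comparison terms telescope to -
  \<alpha> Ln (1 + z).\<close>

lemma qprod_ratio_bound:
  fixes z \<alpha> :: complex
  defines "q \<equiv> \<lambda>t. complex_of_real (exp (- t))"
  assumes t: "t > 0" and M: "1 \<le> M" "norm \<alpha> \<le> M"
  assumes *: "\<And>k v. norm v \<le> M * t \<Longrightarrow> 1 + z * q t ^ k * exp (- v) \<notin> \<real>\<^sub>\<le>\<^sub>0"
             "\<And>k v. norm v \<le> M * t \<Longrightarrow> norm (z * q t ^ k * exp (- v) / (1 + z * q t ^ k * exp (- v))\<^sup>2) \<le> B k"
    and B: "summable B"
  shows "norm (qprod (q t) (z * exp (- (of_real t * \<alpha>))) / qprod (q t) z * exp (\<alpha> * Ln (1 + z)) - 1)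
           \<le> exp (2 * M\<^sup>2 * t\<^sup>2 * suminf B) - 1"
proof -
  interpret nome "q t" unfolding q_def by (rule nome_exp) fact
  define C where "C = 2 * M\<^sup>2 * t\<^sup>2 * suminf B"
  define w where "w = exp (- (of_real t * \<alpha>))"
  have w: "norm (of_real t * \<alpha>) \<le> M * t"
    using M t by (simp add: norm_mult mult.commute mult_left_mono)
  have nz1: "1 + z * q t ^ k \<notin> \<real>\<^sub>\<le>\<^sub>0" for k
    using *(1)[of 0 k] M t by simp
  have nz2: "1 + z * q t ^ k * w \<notin> \<real>\<^sub>\<le>\<^sub>0" for k
    using *(1)[OF w, of k] by (simp add: w_def)
  have nz1': "1 + z * q t ^ k \<noteq> 0" and nz2': "1 + z * q t ^ k * w \<noteq> 0" for k
    using nz1[of k] nz2[of k] by auto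
  \<comment> \<open>The sums \<open>d n\<close> enter the limit only through their exponentials, so
    no logarithm of an infinite product has to be chosen.\<close>
  define d where "d = (\<lambda>n. \<Sum>k<n. Ln (1 + z * q t ^ k * w) - Ln (1 + z * q t ^ k))"
  define c where "c = (\<lambda>n. \<Sum>k<n. \<alpha> * (Ln (1 + z * q t ^ Suc k) - Ln (1 + z * q t ^ k)))"
  have c_eq: "c n = \<alpha> * (Ln (1 + z * q t ^ n) - Ln (1 + z))" for n
    unfolding c_def sum_distrib_left[symmetric] by (subst sum_lessThan_telescope) simp
  have exp_d: "exp (d n) = (\<Prod>k<n. 1 + (z * w) * q t ^ k) / (\<Prod>k<n. 1 + z * q t ^ k)" for n
    unfolding d_def exp_sum[OF finite_lessThan] prod_dividef[symmetric]
    by (intro prod.cong refl) (use nz1' nz2' in \<open>simp add: exp_diff mult_ac\<close>)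
  have dc: "norm (d n - c n) \<le> C" for n
  proof -
    have "norm (d n - c n) \<le> (\<Sum>k<n. 2 * M\<^sup>2 * t\<^sup>2 * B k)"
      unfolding d_def c_def sum_subtractf[symmetric]
    proof (rule sum_norm_le)
      fix k
      have e: "exp (- complex_of_real t) = q t"
        unfolding q_def by (metis exp_of_real of_real_minus)
      have "z * q t ^ k * exp (- complex_of_real t) = z * q t ^ Suc k"
        unfolding e by simp
      thus "norm (Ln (1 + z * q t ^ k * w) - Ln (1 + z * q t ^ k) - 
              \<alpha> * (Ln (1 + z * q t ^ Suc k) - Ln (1 + z * q t ^ k))) \<le> 2 * M\<^sup>2 * t\<^sup>2 * B k"
        using Ln_one_plus_exp_second_order[OF t M *(1)[of _ k] *(2)[of _ k]] by (simp only: w_def)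
    qed
    also have "\<dots> = 2 * M\<^sup>2 * t\<^sup>2 * (\<Sum>k<n. B k)"
      by (simp add: sum_distrib_left)
    also have "(\<Sum>k<n. B k) \<le> suminf B"
      by (intro sum_le_suminf B order.trans[OF norm_ge_zero *(2)[of 0]]) (use M t in auto)
    hence "2 * M\<^sup>2 * t\<^sup>2 * (\<Sum>k<n. B k) \<le> C"
      unfolding C_def by (intro mult_left_mono) auto
    finally show ?thesis .
  qed
  have "(\<lambda>n. exp (d n)) \<longlonglongrightarrow> qprod (q t) (z * w) / qprod (q t) z"
    unfolding exp_d by (intro tendsto_intros qprod_LIMSEQ qprod_nonzero nz1')
  moreover have "(\<lambda>n. z * q t ^ n) \<longlonglongrightarrow> 0"
    using tendsto_mult_left[OF q_power_tendsto_0, of z] by simp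
  hence "c \<longlonglongrightarrow> \<alpha> * (Ln (1 + 0) - Ln (1 + z))"
    unfolding c_eq[abs_def] by (intro tendsto_intros) auto
  ultimately have "(\<lambda>n. exp (d n) / exp (c n)) \<longlonglongrightarrow>
                     qprod (q t) (z * w) / qprod (q t) z / exp (\<alpha> * (Ln (1 + 0) - Ln (1 + z)))"
    by (intro tendsto_intros) auto
  hence lim: "(\<lambda>n. exp (d n - c n)) \<longlonglongrightarrow> qprod (q t) (z * w) / qprod (q t) z * exp (\<alpha> * Ln (1 + z))"
    by (simp add: exp_diff exp_minus divide_inverse)
  have "(\<lambda>n. norm (exp (d n - c n) - 1)) \<longlonglongrightarrow> 
          norm (qprod (q t) (z * w) / qprod (q t) z * exp (\<alpha> * Ln (1 + z)) - 1)"
    by (intro tendsto_intros lim)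
  moreover have "norm (exp (d n - c n) - 1) \<le> exp C - 1" for n
    by (rule order.trans[OF norm_exp_minus_one_le]) (use dc[of n] in simp)
  ultimately show ?thesis
    unfolding C_def[symmetric] w_def[symmetric] by (intro LIMSEQ_le_const2) auto
qed

text \<open>The slit plane is star-shaped about 1. Hence all factors 1 + z q^k, which lie on the
  segment from 1 to 1 + z, stay off the slit together with its end point.\<close>

lemma one_plus_scaled_notin_nonpos_Reals:
  fixes z :: complex and s :: real
  assumes "1 + z \<notin> \<real>\<^sub>\<le>\<^sub>0" "0 \<le> s" "s \<le> 1"
  shows   "1 + of_real s * z \<notin> \<real>\<^sub>\<le>\<^sub>0"
proof
  assume "1 + of_real s * z \<in> \<real>\<^sub>\<le>\<^sub>0"
  hence *: "1 + s * Re z \<le> 0" "s * Im z = 0"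
    by (auto simp: complex_nonpos_Reals_iff)
  hence "s > 0" using assms by (cases "s = 0") auto
  hence "Im z = 0" using * by simp
  moreover have "1 + Re z \<le> 0"
  proof -
    have "Re z \<le> 0"
      using mult_pos_pos[OF \<open>s > 0\<close>, of "Re z"] *(1) by linarith
    hence "Re z \<le> s * Re z"
      using mult_right_mono_neg[OF assms(3)] by simp
    thus ?thesis using *(1) by linarith
  qed
  ultimately show False using assms(1) by (simp add: complex_nonpos_Reals_iff)
qed

text \<open>The argument may move with t, as needed for theta functions, where q / Y occurs. The
  segment from 1 to 1 + z is compact and so keeps a distance \<open>d\<close> from the slit; for
  small t every perturbed factor stays within d / 2 of it. The second derivatives are then dominated
  by a geometric series of sum O(1/t).\<close>

lemma qprod_ratio_tendsto:
  fixes Z :: "real \<Rightarrow> complex" and z \<alpha> :: complex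
  defines "q \<equiv> \<lambda>t. complex_of_real (exp (- t))"
  assumes Z: "(Z \<longlongrightarrow> z) (at_right 0)" and z: "1 + z \<notin> \<real>\<^sub>\<le>\<^sub>0"
  shows "((\<lambda>t. qprod (q t) (Z t * exp (- (of_real t * \<alpha>))) / qprod (q t) (Z t)) \<longlongrightarrow>
            exp (- (\<alpha> * Ln (1 + z)))) (at_right 0)"
proof -
  define M where "M = 1 + norm \<alpha>"
  have M: "1 \<le> M" "norm \<alpha> \<le> M" by (auto simp: M_def)
  define K where "K = (\<lambda>s. 1 + of_real s * z) ` {0..1::real}"
  have "compact K"
    unfolding K_def by (intro compact_continuous_image continuous_intros) auto
  moreover have "K \<inter> \<real>\<^sub>\<le>\<^sub>0 = {}"
    using one_plus_scaled_notin_nonpos_Reals[OF z] by (auto simp: K_def)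
  ultimately obtain d where d: "d > 0" "\<And>x y. x \<in> K \<Longrightarrow> y \<in> \<real>\<^sub>\<le>\<^sub>0 \<Longrightarrow> d \<le> dist x y"
    using separate_compact_closed[of K "\<real>\<^sub>\<le>\<^sub>0"] closed_nonpos_Reals_complex by blast
  \<comment> \<open>The numerator of the second derivative is at most (|z| + d/2) exp (- t)^k, and
    its denominator at least (d/2)^2.\<close>
  define C where "C = (norm z + d / 2) / (d / 2)\<^sup>2"
  \<comment> \<open>This quantity bounds the distance of \<open>Z t * exp (- v)\<close> from
    \<open>z\<close> for all v of norm at most M t.\<close>
  have "((\<lambda>t. norm (Z t) * (exp (M * t) - 1) + norm (Z t - z)) \<longlongrightarrow>
           norm z * (exp (M * 0) - 1) + norm (z - z)) (at_right 0)"
    by (intro tendsto_intros Z)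
  hence ev: "eventually (\<lambda>t. norm (Z t) * (exp (M * t) - 1) + norm (Z t - z) < d / 2) (at_right 0)"
    by (rule order_tendstoD) (use d in auto)
  have tpos: "eventually (\<lambda>t::real. t > 0) (at_right 0)"
    by (rule eventually_at_right_less)
  have "eventually (\<lambda>t. norm (qprod (q t) (Z t * exp (- (of_real t * \<alpha>))) / qprod (q t) (Z t) * exp (\<alpha> * Ln (1 + Z t)) - 1)
           \<le> exp (2 * M\<^sup>2 * t\<^sup>2 * (C * (1 / (1 - exp (- t))))) - 1) (at_right 0)"
    using ev tpos
  proof eventually_elim
    case (elim t)
    have main: "norm (1 + Z t * q t ^ k * exp (- v) - (1 + of_real (exp (- t) ^ k) * z)) < d / 2"
               "norm (Z t * q t ^ k * exp (- v)) \<le> (norm z + d / 2) * exp (- t) ^ k"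
      if v: "norm v \<le> M * t" for k v
    proof -
      have "norm (Z t * exp (- v) - z) = norm (Z t * (exp (- v) - 1) + (Z t - z))"
        by (simp add: algebra_simps)
      also have "\<dots> \<le> norm (Z t) * norm (exp (- v) - 1) + norm (Z t - z)"
        by (rule order.trans[OF norm_triangle_ineq]) (simp add: norm_mult)
      also have "norm (exp (- v) - 1) \<le> exp (M * t) - 1"
        by (rule order.trans[OF norm_exp_minus_one_le]) (use v in simp)
      finally have 1: "norm (Z t * exp (- v) - z) < d / 2"
        using elim by (simp add: mult_left_mono)
      have q1: "0 < exp (- t) ^ k" "exp (- t) ^ k \<le> 1"
        using elim by (auto intro: power_le_one)
      have "1 + Z t * q t ^ k * exp (- v) - (1 + of_real (exp (- t) ^ k) * z) =
              of_real (exp (- t) ^ k) * (Z t * exp (- v) - z)"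
        by (simp add: q_def algebra_simps)
      also have "norm \<dots> \<le> 1 * norm (Z t * exp (- v) - z)"
        unfolding norm_mult using q1 by (intro mult_right_mono) (auto simp: norm_power)
      also have "\<dots> < d / 2" using 1 by simp
      finally show "norm (1 + Z t * q t ^ k * exp (- v) - (1 + of_real (exp (- t) ^ k) * z)) < d / 2" .
      have "norm (Z t * exp (- v)) \<le> norm z + d / 2"
        using 1 norm_triangle_ineq2[of "Z t * exp (- v)" z] by linarith
      hence "norm (Z t * exp (- v)) * exp (- t) ^ k \<le> (norm z + d / 2) * exp (- t) ^ k"
        using q1 by (intro mult_right_mono) auto
      thus "norm (Z t * q t ^ k * exp (- v)) \<le> (norm z + d / 2) * exp (- t) ^ k"
        by (simp add: q_def norm_mult norm_power mult_ac)
    qed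
    have far: "dist (1 + Z t * q t ^ k * exp (- v)) y \<ge> d / 2"
      if v: "norm v \<le> M * t" and y: "y \<in> \<real>\<^sub>\<le>\<^sub>0" for k v y
    proof -
      have "1 + of_real (exp (- t) ^ k) * z \<in> K"
        unfolding K_def using elim by (intro imageI) (auto intro: power_le_one)
      from d(2)[OF this y] show ?thesis
        using main(1)[OF v, of k]
              dist_triangle[of "1 + of_real (exp (- t) ^ k) * z" y "1 + Z t * q t ^ k * exp (- v)"]
        unfolding dist_norm norm_minus_commute[of "1 + of_real (exp (- t) ^ k) * z" "1 + Z t * q t ^ k * exp (- v)"]
        by linarith
    qed
    have "norm (qprod (q t) (Z t * exp (- (of_real t * \<alpha>))) / qprod (q t) (Z t) * exp (\<alpha> * Ln (1 + Z t)) - 1)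
           \<le> exp (2 * M\<^sup>2 * t\<^sup>2 * suminf (\<lambda>k. C * exp (- t) ^ k)) - 1"
      unfolding q_def
    proof (rule qprod_ratio_bound)
      fix v :: complex and k assume v: "norm v \<le> M * t"
      show "1 + Z t * complex_of_real (exp (- t)) ^ k * exp (- v) \<notin> \<real>\<^sub>\<le>\<^sub>0"
        using far[OF v, of "1 + Z t * q t ^ k * exp (- v)" k] d unfolding q_def by auto
      have "norm (1 + Z t * q t ^ k * exp (- v)) \<ge> d / 2"
        using far[OF v, of 0 k] by simp
      hence "norm (Z t * q t ^ k * exp (- v)) / norm (1 + Z t * q t ^ k * exp (- v)) ^ 2 \<le>
               ((norm z + d / 2) * exp (- t) ^ k) / (d / 2) ^ 2"
        using d by (intro frac_le main(2)[OF v] power_mono) auto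
      thus "norm (Z t * complex_of_real (exp (- t)) ^ k * exp (- v) /
              (1 + Z t * complex_of_real (exp (- t)) ^ k * exp (- v))\<^sup>2) \<le> C * exp (- t) ^ k"
        by (simp add: C_def q_def norm_divide norm_power)
    qed (use M elim in \<open>auto intro!: summable_mult summable_geometric\<close>)
    also have "suminf (\<lambda>k. C * exp (- t) ^ k) = C * (1 / (1 - exp (- t)))"
      using elim by (subst suminf_mult) (auto simp: suminf_geometric)
    finally show ?case .
  qed
  moreover have "((\<lambda>t. exp (2 * M\<^sup>2 * t\<^sup>2 * (C * (1 / (1 - exp (- t))))) - 1) \<longlongrightarrow> 0) (at_right 0)"
  proof -
    have "((\<lambda>t::real. t\<^sup>2 * (1 / (1 - exp (- t)))) \<longlongrightarrow> 0) (at_right 0)"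
      by real_asymp
    hence "((\<lambda>t. exp (2 * M\<^sup>2 * C * (t\<^sup>2 * (1 / (1 - exp (- t))))) - 1) \<longlongrightarrow> exp (2 * M\<^sup>2 * C * 0) - 1) (at_right 0)"
      by (intro tendsto_intros)
    thus ?thesis by (simp add: mult_ac)
  qed
  ultimately have "((\<lambda>t. qprod (q t) (Z t * exp (- (of_real t * \<alpha>))) / qprod (q t) (Z t) * exp (\<alpha> * Ln (1 + Z t)) - 1) \<longlongrightarrow> 0) (at_right 0)"
    by (rule Lim_null_comparison)
  hence "((\<lambda>t. qprod (q t) (Z t * exp (- (of_real t * \<alpha>))) / qprod (q t) (Z t) * exp (\<alpha> * Ln (1 + Z t))) \<longlongrightarrow> 1) (at_right 0)"
    by (simp add: LIM_zero_iff)
  moreover have "((\<lambda>t. exp (- (\<alpha> * Ln (1 + Z t)))) \<longlongrightarrow> exp (- (\<alpha> * Ln (1 + z)))) (at_right 0)"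
    by (intro tendsto_intros Z z)
  ultimately have "((\<lambda>t. qprod (q t) (Z t * exp (- (of_real t * \<alpha>))) / qprod (q t) (Z t) * exp (\<alpha> * Ln (1 + Z t)) *
                      exp (- (\<alpha> * Ln (1 + Z t)))) \<longlongrightarrow> 1 * exp (- (\<alpha> * Ln (1 + z)))) (at_right 0)"
    by (rule tendsto_mult)
  thus ?thesis by (simp add: mult.assoc flip: exp_add)
qed

lemma one_minus_exp_over_tendsto:
  fixes c :: complex
  shows "((\<lambda>t. (1 - exp (- (of_real t * c))) / of_real t) \<longlongrightarrow> c) (at_right (0::real))"
proof -
  have "((\<lambda>z. 1 - exp (- (z * c))) has_field_derivative c) (at 0)"
    by (auto intro!: derivative_eq_intros)
  hence "((\<lambda>z. (1 - exp (- (z * c))) / z) \<longlongrightarrow> c) (at 0)"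
    by (simp add: DERIV_def)
  moreover have "filterlim complex_of_real (at 0) (at_right 0)"
    unfolding filterlim_at
    using eventually_at_right_less[of "0::real"] tendsto_of_real[OF tendsto_ident_at[of 0 "{0<..}"]]
    by (auto elim!: eventually_mono)
  ultimately show ?thesis
    by (rule filterlim_compose)
qed

lemma q_power_eq: "complex_of_real (exp (- t)) ^ n = exp (- (of_real t * of_nat n))"
proof -
  have "complex_of_real (exp (- t)) ^ n = exp (of_nat n * (- of_real t))"
    by (metis exp_of_nat_mult exp_of_real of_real_minus)
  thus ?thesis by (simp add: mult.commute)
qed

lemma q_quotient_tendsto:
  fixes c d :: complex
  assumes "d \<noteq> 0"
  shows "((\<lambda>t::real. (1 - exp (- (of_real t * c))) / (1 - exp (- (of_real t * d)))) \<longlongrightarrow> c / d) (at_right 0)"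
proof -
  have "((\<lambda>t::real. ((1 - exp (- (of_real t * c))) / of_real t) / ((1 - exp (- (of_real t * d))) / of_real t)) \<longlongrightarrow> c / d) (at_right 0)"
    by (intro tendsto_divide one_minus_exp_over_tendsto assms)
  moreover have "eventually (\<lambda>t::real. ((1 - exp (- (of_real t * c))) / of_real t) / ((1 - exp (- (of_real t * d))) / of_real t) =
      (1 - exp (- (of_real t * c))) / (1 - exp (- (of_real t * d)))) (at_right 0)"
    using eventually_at_right_less[of 0] by eventually_elim simp
  ultimately show ?thesis
    by (rule Lim_transform_eventually)
qed

text \<open>The arguments of y and 1 + y lie on the same side of the real axis, so they differ by
  less than pi and no multiple of 2 pi i appears.\<close>

lemma Ln_inverse_shift:
  assumes "y \<notin> \<real>\<^sub>\<le>\<^sub>0"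
  shows   "Ln (1 + 1 / y) = Ln (1 + y) - Ln y"
proof (rule Ln_unique)
  have nz: "y \<noteq> 0" "1 + y \<noteq> 0"
    using assms by (auto simp: complex_nonpos_Reals_iff add_eq_0_iff)
  show "exp (Ln (1 + y) - Ln y) = 1 + 1 / y"
    using nz by (simp add: exp_diff field_simps)
  have A: "\<bar>Im (Ln w)\<bar> < pi" if "w \<notin> \<real>\<^sub>\<le>\<^sub>0" for w
  proof -
    have "w \<noteq> 0" using that by auto
    moreover have "Im (Ln w) \<noteq> pi"
      using that \<open>w \<noteq> 0\<close> by (auto simp: Im_Ln_eq_pi complex_nonpos_Reals_iff)
    ultimately show ?thesis
      using mpi_less_Im_Ln[of w] Im_Ln_le_pi[of w] by auto
  qed
  have y1: "1 + y \<notin> \<real>\<^sub>\<le>\<^sub>0"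
    using assms by (auto simp: complex_nonpos_Reals_iff)
  consider "Im y > 0" | "Im y < 0" | "Im y = 0" by linarith
  hence "\<bar>Im (Ln (1 + y)) - Im (Ln y)\<bar> < pi"
  proof cases
    case 1
    thus ?thesis using Im_Ln_pos_lt_imp[of y] Im_Ln_pos_lt_imp[of "1 + y"] by auto
  next
    case 2
    have "Im (Ln y) < 0" "Im (Ln (1 + y)) < 0"
      using 2 nz Im_Ln_pos_le[of y] Im_Ln_pos_le[of "1 + y"] Im_Ln_le_pi[of y] Im_Ln_le_pi[of "1 + y"]
      by (auto simp: not_le)
    thus ?thesis using A[OF assms] A[OF y1] by auto
  next
    case 3
    hence "Re y > 0" using assms by (auto simp: complex_nonpos_Reals_iff)
    hence "Im (Ln y) = 0" "Im (Ln (1 + y)) = 0"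
      using 3 nz by (auto simp: Im_Ln_eq_0)
    thus ?thesis by simp
  qed
  thus "- pi < Im (Ln (1 + y) - Ln y)" "Im (Ln (1 + y) - Ln y) \<le> pi"
    by auto
qed

text \<open>In the triple product (q;q)_inf cancels; the factors at Y and q / Y contribute (1 +
  y)^(-\<alpha>) and (1 + 1/y)^\<alpha>, which combine to y^(-\<alpha>).\<close>

lemma theta_ratio_tendsto:
  fixes Y :: "real \<Rightarrow> complex" and y \<alpha> :: complex
  defines "q \<equiv> \<lambda>t. complex_of_real (exp (- t))"
  assumes Y: "(Y \<longlongrightarrow> y) (at_right 0)" and y: "y \<notin> \<real>\<^sub>\<le>\<^sub>0"
  shows "((\<lambda>t. theta (q t) (Y t * exp (- (of_real t * \<alpha>))) / theta (q t) (Y t)) \<longlongrightarrow>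
            exp (- (\<alpha> * Ln y))) (at_right 0)"
proof -
  have y0: "y \<noteq> 0" using y by auto
  have y1: "1 + y \<notin> \<real>\<^sub>\<le>\<^sub>0"
    using y by (auto simp: complex_nonpos_Reals_iff)
  have y2: "1 + 1 / y \<notin> \<real>\<^sub>\<le>\<^sub>0"
  proof
    assume "1 + 1 / y \<in> \<real>\<^sub>\<le>\<^sub>0"
    then obtain r where r: "1 + 1 / y = of_real r" "r \<le> 0"
      by (auto elim!: nonpos_Reals_cases)
    hence "1 / y = of_real (r - 1)" by (simp add: algebra_simps)
    hence "1 / (1 / y) = of_real (1 / (r - 1))" by simp
    hence "y = of_real (1 / (r - 1))" by simp
    moreover have "1 / (r - 1) \<le> 0" using r by (simp add: divide_le_0_iff)
    ultimately show False using y by (metis nonpos_Reals_of_real_iff)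
  qed
  have q_lim: "(q \<longlongrightarrow> 1) (at_right 0)"
  proof -
    have "(q \<longlongrightarrow> complex_of_real (exp (- 0))) (at_right 0)"
      unfolding q_def by (intro tendsto_intros)
    thus ?thesis by simp
  qed
  have 1: "((\<lambda>t. qprod (q t) (Y t * exp (- (of_real t * \<alpha>))) / qprod (q t) (Y t)) \<longlongrightarrow>
            exp (- (\<alpha> * Ln (1 + y)))) (at_right 0)"
    unfolding q_def by (rule qprod_ratio_tendsto[OF Y y1])
  have "((\<lambda>t. q t / Y t) \<longlongrightarrow> 1 / y) (at_right 0)"
    by (intro tendsto_intros q_lim Y y0)
  from qprod_ratio_tendsto[OF this y2, of "- \<alpha>"]
  have 2: "((\<lambda>t. qprod (q t) (q t / Y t * exp (- (of_real t * (- \<alpha>)))) / qprod (q t) (q t / Y t)) \<longlongrightarrow>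
            exp (- ((- \<alpha>) * Ln (1 + 1 / y)))) (at_right 0)"
    by (simp add: q_def)
  have "((\<lambda>t. (qprod (q t) (Y t * exp (- (of_real t * \<alpha>))) / qprod (q t) (Y t)) *
              (qprod (q t) (q t / Y t * exp (- (of_real t * (- \<alpha>)))) / qprod (q t) (q t / Y t))) \<longlongrightarrow>
            exp (- (\<alpha> * Ln (1 + y))) * exp (- ((- \<alpha>) * Ln (1 + 1 / y)))) (at_right 0)"
    by (intro tendsto_mult 1 2)
  also have "exp (- (\<alpha> * Ln (1 + y))) * exp (- ((- \<alpha>) * Ln (1 + 1 / y))) = exp (- (\<alpha> * Ln y))"
    unfolding Ln_inverse_shift[OF y] exp_add[symmetric] by (simp add: algebra_simps)
  finally have "((\<lambda>t. (qprod (q t) (Y t * exp (- (of_real t * \<alpha>))) / qprod (q t) (Y t)) *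
              (qprod (q t) (q t / Y t * exp (- (of_real t * (- \<alpha>)))) / qprod (q t) (q t / Y t))) \<longlongrightarrow>
            exp (- (\<alpha> * Ln y))) (at_right 0)" .
  moreover have "eventually (\<lambda>t. (qprod (q t) (Y t * exp (- (of_real t * \<alpha>))) / qprod (q t) (Y t)) *
              (qprod (q t) (q t / Y t * exp (- (of_real t * (- \<alpha>)))) / qprod (q t) (q t / Y t)) =
       theta (q t) (Y t * exp (- (of_real t * \<alpha>))) / theta (q t) (Y t)) (at_right 0)"
    using eventually_at_right_less[of 0] tendsto_imp_eventually_ne[OF Y y0]
  proof eventually_elim
    case (elim t)
    interpret nome "q t" unfolding q_def using elim by (intro nome_exp)
    have e: "q t / (Y t * exp (- (of_real t * \<alpha>))) = q t / Y t * exp (- (of_real t * (- \<alpha>)))"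
      by (simp add: exp_minus divide_inverse)
    have "theta (q t) (Y t * exp (- (of_real t * \<alpha>))) =
            qprod (q t) (- q t) * qprod (q t) (Y t * exp (- (of_real t * \<alpha>))) * 
            qprod (q t) (q t / Y t * exp (- (of_real t * (- \<alpha>))))"
      unfolding e[symmetric] by (rule jacobi_triple_product) (use elim in simp)
    moreover have "theta (q t) (Y t) = qprod (q t) (- q t) * qprod (q t) (Y t) * qprod (q t) (q t / Y t)"
      using elim by (intro jacobi_triple_product) auto
    ultimately show ?case
      using qprod_minus_q_nz by simp
  qed
  ultimately show ?thesis
    by (rule Lim_transform_eventually)
qed

section \<open>The q-exponential function\<close>

text \<open>Each of the k + 1 terms of 1 + r + ... + r^k is at least r^k, so one step of the
  recurrence gains a factor of at most 1 / (k + 1). The bound is uniform in r and serves as majorant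
  in Tannery's theorem.\<close>

lemma euler_coeff_bound:
  assumes r: "0 < r" "r < 1"
  shows   "norm (euler_coeff (of_real r) k * (1 - of_real r) ^ k) \<le> 1 / fact k"
proof (induction k)
  case (Suc k)
  have "real (Suc k) * r ^ k = (\<Sum>i<Suc k. r ^ k)" by simp
  also have "\<dots> \<le> (\<Sum>i<Suc k. r ^ i)"
    using r by (intro sum_mono power_decreasing) auto
  finally have "(1 - r) * (real (Suc k) * r ^ k) \<le> (1 - r) * (\<Sum>i<Suc k. r ^ i)"
    using r by (intro mult_left_mono) auto
  also have "\<dots> = 1 - r ^ Suc k"
    by (rule one_diff_power_eq[symmetric])
  finally have "r ^ k * (1 - r) * real (Suc k) \<le> 1 - r ^ Suc k"
    by (simp add: mult_ac)
  moreover have pos: "1 - r ^ Suc k > 0"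
    using r by (simp add: power_less_one_iff del: power_Suc)
  ultimately have "r ^ k * (1 - r) / (1 - r ^ Suc k) \<le> 1 / real (Suc k)"
    by (simp add: field_simps del: power_Suc of_nat_Suc)
  hence *: "norm (complex_of_real (r ^ k * (1 - r) / (1 - r ^ Suc k))) \<le> 1 / real (Suc k)"
    using r pos unfolding norm_of_real by (simp del: power_Suc of_nat_Suc)
  have "euler_coeff (of_real r) (Suc k) * (1 - of_real r) ^ Suc k =
          (euler_coeff (of_real r) k * (1 - of_real r) ^ k) * of_real (r ^ k * (1 - r) / (1 - r ^ Suc k))"
    by (simp add: euler_coeff_Suc)
  also have "norm \<dots> \<le> 1 / fact k * (1 / real (Suc k))"
    unfolding norm_mult[of "euler_coeff _ _ * _"] by (intro mult_mono Suc.IH *) auto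
  finally show ?case by (simp add: mult.commute)
qed auto

lemma euler_coeff_tendsto:
  "((\<lambda>t. euler_coeff (of_real (exp (- t))) k * (1 - of_real (exp (- t))) ^ k) \<longlongrightarrow> 1 / fact k) (at_right 0)"
proof (induction k)
  case (Suc k)
  have q1: "complex_of_real (exp (- t)) = exp (- (of_real t * 1))" for t
    using q_power_eq[of t 1] by simp
  have "((\<lambda>t. exp (- (complex_of_real t * of_nat k))) \<longlongrightarrow> exp (- (complex_of_real 0 * of_nat k))) (at_right 0)"
    by (intro tendsto_intros)
  hence "((\<lambda>t. (euler_coeff (of_real (exp (- t))) k * (1 - of_real (exp (- t))) ^ k) *
              (exp (- (complex_of_real t * of_nat k)) * 
               ((1 - exp (- (of_real t * 1))) / (1 - exp (- (of_real t * of_nat (Suc k)))))))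
           \<longlongrightarrow> 1 / fact k * (1 * (1 / of_nat (Suc k)))) (at_right 0)"
    by (intro tendsto_mult Suc.IH q_quotient_tendsto) (simp_all del: of_nat_Suc)
  also have "(\<lambda>t. (euler_coeff (of_real (exp (- t))) k * (1 - of_real (exp (- t))) ^ k) *
              (exp (- (complex_of_real t * of_nat k)) * 
               ((1 - exp (- (of_real t * 1))) / (1 - exp (- (of_real t * of_nat (Suc k))))))) =
             (\<lambda>t. euler_coeff (of_real (exp (- t))) (Suc k) * (1 - of_real (exp (- t))) ^ Suc k)"
    unfolding q_power_eq[symmetric] q1[symmetric] euler_coeff_Suc by (simp add: mult_ac)
  finally show ?case by (simp add: mult.commute)
qed auto

lemma qprod_tendsto_exp:
  fixes Y :: "real \<Rightarrow> complex"
  assumes Y: "(Y \<longlongrightarrow> y) (at_right 0)"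
  shows "((\<lambda>t. qprod (of_real (exp (- t))) ((1 - of_real (exp (- t))) * Y t)) \<longlongrightarrow> exp y) (at_right 0)"
proof -
  define a where "a = (\<lambda>k t. euler_coeff (of_real (exp (- t))) k * (1 - of_real (exp (- t))) ^ k * Y t ^ k)"
  define R where "R = norm y + 1"
  have "eventually (\<lambda>t. norm (Y t) < R) (at_right 0)"
    using tendsto_norm[OF Y] by (rule order_tendstoD) (simp add: R_def)
  hence "eventually (\<lambda>t. \<forall>k. norm (a k t) \<le> R ^ k / fact k) (at_right 0)"
    using eventually_at_right_less[of 0]
  proof eventually_elim
    case (elim t)
    show ?case
    proof
      fix k
      have "norm (a k t) = norm (euler_coeff (of_real (exp (- t))) k * (1 - of_real (exp (- t))) ^ k) * norm (Y t) ^ k"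
        by (simp add: a_def norm_mult norm_power)
      also have "\<dots> \<le> 1 / fact k * R ^ k"
        using elim by (intro mult_mono euler_coeff_bound power_mono) auto
      finally have "norm (a k t) \<le> 1 / fact k * R ^ k" .
      thus "norm (a k t) \<le> R ^ k / fact k" by simp
    qed
  qed
  hence bound: "eventually (\<lambda>(k, t). norm (a k t) \<le> R ^ k / fact k) (at_top \<times>\<^sub>F at_right 0)"
    by (subst eventually_prod_filter)
       (auto intro!: exI[of _ "\<lambda>_. True"] exI[of _ "\<lambda>t. \<forall>k. norm (a k t) \<le> R ^ k / fact k"])
  have "((\<lambda>t. \<Sum>k. a k t) \<longlongrightarrow> (\<Sum>k. 1 / fact k * y ^ k)) (at_right 0)"
  proof (rule conjunct2[OF conjunct2[OF tannerys_theorem[OF _ bound]]])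
    show "(a k \<longlongrightarrow> 1 / fact k * y ^ k) (at_right 0)" for k
      unfolding a_def by (intro tendsto_intros euler_coeff_tendsto Y)
    show "summable (\<lambda>k. R ^ k / fact k)"
      using summable_exp[of R] by (simp add: field_simps)
  qed auto
  also have "(\<Sum>k. 1 / fact k * y ^ k) = exp y"
    by (simp add: exp_def scaleR_conv_of_real divide_inverse)
  also have "(\<lambda>t. \<Sum>k. a k t) = (\<lambda>t. qprod (of_real (exp (- t))) ((1 - of_real (exp (- t))) * Y t))"
    by (simp add: a_def qprod_def power_mult_distrib mult_ac)
  finally show ?thesis .
qed

section \<open>The \<open>q\<close>-Gamma function\<close>

text \<open>This controls the second derivative of the logarithm near its singularity: the quotient
  is 1 / (2 sinh (u/2))^2, with a double pole at 0. The inverse square is summable over u in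
  arithmetic progression.\<close>

lemma norm_exp_quotient_le:
  fixes u :: complex
  assumes "Re u > 0"
  shows "norm (exp (- u) / (1 - exp (- u))\<^sup>2) \<le> 4 / (Re u)\<^sup>2"
proof -
  define r where "r = Re u"
  have r: "r > 0" using assms by (simp add: r_def)
  have e: "norm (exp (- u)) = exp (- r)"
    by (simp add: r_def norm_exp_eq_Re)
  \<comment> \<open>The exponential needs a quadratic lower bound here, to absorb the (1 + r)^2 that
    the denominator produces.\<close>
  have "exp r = exp (r / 2) * exp (r / 2)"
    by (simp flip: exp_add)
  moreover have "exp (r / 2) \<ge> 1 + r / 2" by (rule exp_ge_add_one_self)
  ultimately have e1: "exp r \<ge> (1 + r / 2) * (1 + r / 2)"
    using r by (simp add: mult_mono)
  have "exp (- r) = 1 / exp r"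
    by (simp add: exp_minus divide_inverse)
  also have "\<dots> \<le> 1 / ((1 + r / 2) * (1 + r / 2))"
    using r by (intro divide_left_mono[OF e1] mult_pos_pos) auto
  finally have e2: "exp (- r) \<le> 1 / (1 + r / 2)\<^sup>2"
    by (simp only: power2_eq_square)
  have "exp (- r) \<le> 1 / (1 + r)"
    using exp_ge_add_one_self[of r] r by (simp add: exp_minus field_simps)
  moreover have "1 - 1 / (1 + r) = r / (1 + r)"
    using r by (simp add: field_simps)
  ultimately have "r / (1 + r) \<le> 1 - exp (- r)" by linarith
  also have "\<dots> \<le> norm (1 - exp (- u))"
    using norm_triangle_ineq2[of 1 "exp (- u)", unfolded e] by simp
  finally have lower: "r / (1 + r) \<le> norm (1 - exp (- u))" .
  have "norm (exp (- u)) / norm (1 - exp (- u)) ^ 2 \<le> (1 / (1 + r / 2)\<^sup>2) / (r / (1 + r)) ^ 2"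
    unfolding e using e2 lower r by (intro frac_le power_mono) auto
  also have "\<dots> = ((1 + r) / (1 + r / 2))\<^sup>2 / r\<^sup>2"
    by (simp add: power_divide)
  also have "((1 + r) / (1 + r / 2))\<^sup>2 \<le> 2\<^sup>2"
    using r by (intro power_mono) (auto simp: field_simps)
  hence "((1 + r) / (1 + r / 2))\<^sup>2 / r\<^sup>2 \<le> 4 / r\<^sup>2"
    by (intro divide_right_mono) auto
  finally show ?thesis by (simp add: r_def norm_divide norm_power)
qed

text \<open>An interchange of limits: n is chosen first, then t. Once
  \<open>\<delta> n < 1 / 2\<close>, the factor \<open>R n t\<close> has norm at least 1/2, which
  bounds \<open>f\<close> by twice \<open>A n\<close>; then \<open>f - A n\<close> is small because
  \<open>R n t - 1\<close> is.\<close>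

lemma tendsto_of_approximate_factor:
  fixes f :: "'a \<Rightarrow> complex" and A R :: "nat \<Rightarrow> 'a \<Rightarrow> complex"
  assumes ev: "\<And>n. eventually (\<lambda>t. f t * R n t = A n t \<and> norm (R n t - 1) \<le> \<delta> n) F"
    and A: "\<And>n. (A n \<longlongrightarrow> a n) F" and a: "a \<longlonglongrightarrow> g" and \<delta>: "\<delta> \<longlonglongrightarrow> 0"
  shows "(f \<longlongrightarrow> g) F"
proof (rule tendstoI)
  fix e :: real assume e: "e > 0"
  have "(\<lambda>n. 2 * \<delta> n * (norm (a n) + 1)) \<longlonglongrightarrow> 2 * 0 * (norm g + 1)"
    by (intro tendsto_intros a \<delta>)
  hence 1: "eventually (\<lambda>n. 2 * \<delta> n * (norm (a n) + 1) < e / 3) sequentially"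
    by (rule order_tendstoD) (use e in auto)
  have 2: "eventually (\<lambda>n. \<delta> n < 1 / 2) sequentially"
    using \<delta> by (rule order_tendstoD) auto
  have 3: "eventually (\<lambda>n. dist (a n) g < e / 3) sequentially"
    using a e by (intro tendstoD) auto
  obtain n where n: "2 * \<delta> n * (norm (a n) + 1) < e / 3" "\<delta> n < 1 / 2" "dist (a n) g < e / 3"
    using eventually_happens[OF eventually_conj[OF 1 eventually_conj[OF 2 3]]] by auto
  have "eventually (\<lambda>t. dist (A n t) (a n) < min 1 (e / 3)) F"
    using A e by (intro tendstoD) auto
  thus "eventually (\<lambda>t. dist (f t) g < e) F"
    using ev[of n]
  proof eventually_elim
    case (elim t)
    have "1 \<le> norm (R n t) + norm (R n t - 1)"
      using norm_triangle_ineq4[of "R n t" "R n t - 1"] by simp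
    hence "norm (R n t) \<ge> 1 / 2" using elim n(2) by linarith
    hence "norm (f t) * (1 / 2) \<le> norm (f t) * norm (R n t)"
      by (intro mult_left_mono) auto
    also have "\<dots> = norm (A n t)" using elim by (simp flip: norm_mult)
    also have "\<dots> \<le> norm (a n) + 1"
      using elim norm_triangle_ineq2[of "A n t" "a n"] by (simp add: dist_norm)
    finally have f: "norm (f t) \<le> 2 * (norm (a n) + 1)" by simp
    have "f t - A n t = - (f t * (R n t - 1))"
      using elim by (simp add: algebra_simps)
    hence "norm (f t - A n t) = norm (f t) * norm (R n t - 1)"
      by (simp add: norm_mult)
    also have "\<dots> \<le> 2 * (norm (a n) + 1) * \<delta> n"
      using f elim by (intro mult_mono) (auto simp: add_nonneg_nonneg)
    also have "\<dots> < e / 3" using n(1) by (simp add: mult_ac)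
    finally have "dist (f t) (A n t) < e / 3" by (simp add: dist_norm)
    moreover have "dist (A n t) (a n) < e / 3" using elim by simp
    ultimately show ?case
      using n(3) dist_triangle[of "f t" g "A n t"] dist_triangle[of "A n t" g "a n"] by linarith
  qed
qed

lemma summable_inverse_square_shift: "summable (\<lambda>k. 1 / (real (n + k) + 1)\<^sup>2)"
proof -
  have "summable (\<lambda>k. inverse (real (Suc k) ^ 2))"
    using inverse_power_summable[of 2, where 'a = real] by (subst summable_Suc_iff) auto
  hence "summable (\<lambda>k. inverse (real (Suc (k + n)) ^ 2))"
    by (subst summable_iff_shift)
  thus ?thesis by (simp add: divide_inverse add_ac)
qed

lemma inverse_square_tail_tendsto:
  "(\<lambda>n. \<Sum>k. 1 / (real (n + k) + 1)\<^sup>2) \<longlonglongrightarrow> 0"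
proof -
  define h :: "nat \<Rightarrow> real" where "h = (\<lambda>k. 1 / (real k + 1)\<^sup>2)"
  have h: "summable h"
    using summable_inverse_square_shift[of 0] by (simp add: h_def)
  have "(\<Sum>k. 1 / (real (n + k) + 1)\<^sup>2) = suminf h - sum h {..<n}" for n
    using suminf_minus_initial_segment[OF h, of n] by (simp add: h_def add_ac)
  moreover have "(\<lambda>n. suminf h - sum h {..<n}) \<longlonglongrightarrow> suminf h - suminf h"
    by (intro tendsto_intros summable_LIMSEQ h)
  ultimately show ?thesis by simp
qed

text \<open>
  The finitely many factors near the singularity of the logarithm are split off; the logarithms
  of the remaining ones are close to a telescoping sum, uniformly in \<open>t\<close>.
\<close>

lemma q_Gamma_tendsto:
  fixes s :: complex
  defines "q \<equiv> \<lambda>t. complex_of_real (exp (- t))"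
  assumes s: "1 + s \<notin> \<int>\<^sub>\<le>\<^sub>0"
  shows "((\<lambda>t. qprod (q t) (- q t) / qprod (q t) (- (q t * exp (- (of_real t * s)))) *
                exp (- (s * of_real (ln (1 - exp (- t)))))) \<longlongrightarrow> Gamma (1 + s)) (at_right 0)"
proof -
  define M where "M = 1 + norm s"
  have M: "1 \<le> M" "norm s \<le> M" by (auto simp: M_def)
  \<comment> \<open>Skipping m \<ge> M further factors compensates a perturbation v of norm at most
    M t: the exponents t (m + n + k + 1) + v keep real part at least t (n + k + 1).\<close>
  define m where "m = nat \<lceil>M\<rceil>"
  have m: "real m \<ge> M" unfolding m_def using M by linarith
  define N where "N = (\<lambda>n. m + n)"
  define z where "z = (\<lambda>n t. - (q t ^ Suc (N n)))"
  define E where "E = (\<lambda>t::real. exp (- (of_real t * s)))"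
  define f where "f = (\<lambda>t. qprod (q t) (- q t) / qprod (q t) (- (q t * E t)) *
                exp (- (s * of_real (ln (1 - exp (- t))))))"
  define R where "R = (\<lambda>n t. qprod (q t) (z n t * E t) / qprod (q t) (z n t) * exp (s * Ln (1 + z n t)))"
  \<comment> \<open>The normalisation (1 - q)^(-s) and the factor (1 - q^(N+1))^s from
    \<open>R\<close> combine to a power of the geometric sum, which tends to (N + 1)^s.\<close>
  define A where "A = (\<lambda>n t. (\<Prod>k<N n. (1 - q t ^ Suc k) / (1 - q t ^ Suc k * E t)) *
                exp (s * of_real (ln (\<Sum>i<Suc (N n). exp (- t) ^ i))))"
  define a where "a = (\<lambda>n. (\<Prod>k<N n. of_nat (Suc k) / (of_nat (Suc k) + s)) *
                exp (s * of_real (ln (real (Suc (N n))))))"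
  \<comment> \<open>Here 8 is 2 * 4, from the second-order estimate and
    \<open>norm_exp_quotient_le\<close>. The t^2 of the former cancels the 1 / t^2 of the latter, so
    the bound is free of t.\<close>
  define \<delta> where "\<delta> = (\<lambda>n. exp (8 * M\<^sup>2 * (\<Sum>k. 1 / (real (n + k) + 1)\<^sup>2)) - 1)"
  have s_nz: "of_nat (Suc k) + s \<noteq> 0" for k
  proof
    assume "of_nat (Suc k) + s = 0"
    moreover have "1 + s = (of_nat (Suc k) + s) - of_nat k" by simp
    ultimately have "1 + s = - of_nat k" by simp
    with s show False by simp
  qed

  have "(f \<longlongrightarrow> Gamma (1 + s)) (at_right 0)"
  proof (rule tendsto_of_approximate_factor)
    fix n
    show "eventually (\<lambda>t. f t * R n t = A n t \<and> norm (R n t - 1) \<le> \<delta> n) (at_right 0)"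
      using eventually_at_right_less[of 0]
    proof eventually_elim
      case (elim t)
      interpret nome "q t" unfolding q_def using elim by (intro nome_exp)
      have x01: "0 < exp (- t)" "exp (- t) < 1" using elim by auto
      have expu: "z n t * q t ^ k * exp (- v) = - exp (- (of_real (t * real (Suc (N n + k))) + v))" for k v
      proof -
        have "z n t * q t ^ k * exp (- v) = - (q t ^ Suc (N n + k) * exp (- v))"
          by (simp add: z_def power_add)
        thus ?thesis
          unfolding q_def q_power_eq exp_add[symmetric] by simp
      qed
      have Re_u: "Re (of_real (t * real (Suc (N n + k))) + v) \<ge> t * (real (n + k) + 1)"
        if v: "norm v \<le> M * t" for k v
      proof -
        have "- Re v \<le> t * M"
          using abs_Re_le_cmod[of v] v by (simp add: mult.commute)
        also have "\<dots> \<le> t * real m" using m elim by (intro mult_left_mono) auto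
        finally show ?thesis by (simp add: N_def algebra_simps)
      qed
      have pos: "t * (real (n + k) + 1) > 0" for k using elim by simp
      have norm1: "norm (z n t * q t ^ k * exp (- v)) < 1" if v: "norm v \<le> M * t" for k v
        unfolding expu norm_minus_cancel norm_exp_eq_Re using Re_u[OF v, of k] pos[of k] by simp
      have notin: "1 + w \<notin> \<real>\<^sub>\<le>\<^sub>0" if "norm w < 1" for w :: complex
        using that abs_Re_le_cmod[of w] by (auto simp: complex_nonpos_Reals_iff)
      have Ms: "norm (of_real t * s) \<le> M * t" 
        using M elim by (simp add: norm_mult mult.commute mult_left_mono)

      have "norm (R n t - 1) \<le> exp (2 * M\<^sup>2 * t\<^sup>2 * suminf (\<lambda>k. 4 / (t * (real (n + k) + 1))\<^sup>2)) - 1"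
        unfolding R_def E_def q_def
      proof (rule qprod_ratio_bound[OF elim M])
        fix k :: nat and v :: complex assume v: "norm v \<le> M * t"
        define u where "u = of_real (t * real (Suc (N n + k))) + v"
        have u: "Re u \<ge> t * (real (n + k) + 1)"
          unfolding u_def by (rule Re_u[OF v])
        show "1 + z n t * complex_of_real (exp (- t)) ^ k * exp (- v) \<notin> \<real>\<^sub>\<le>\<^sub>0"
          using notin[OF norm1[OF v, of k]] unfolding q_def .
        have "norm (exp (- u) / (1 - exp (- u))\<^sup>2) \<le> 4 / (Re u)\<^sup>2"
          using u pos[of k] by (intro norm_exp_quotient_le) linarith
        also have "\<dots> \<le> 4 / (t * (real (n + k) + 1))\<^sup>2"
          using u pos[of k] by (intro divide_left_mono power_mono) (auto intro!: mult_pos_pos)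
        finally have "norm (z n t * q t ^ k * exp (- v) / (1 + z n t * q t ^ k * exp (- v))\<^sup>2)
                       \<le> 4 / (t * (real (n + k) + 1))\<^sup>2"
          unfolding expu u_def[symmetric] by (simp add: norm_divide)
        thus "norm (z n t * complex_of_real (exp (- t)) ^ k * exp (- v) /
               (1 + z n t * complex_of_real (exp (- t)) ^ k * exp (- v))\<^sup>2) \<le> 4 / (t * (real (n + k) + 1))\<^sup>2"
          unfolding q_def .
      next
        from summable_mult[OF summable_inverse_square_shift[of n], of "4 / t\<^sup>2"]
        show "summable (\<lambda>k. 4 / (t * (real (n + k) + 1))\<^sup>2)"
          by (simp add: power_mult_distrib add_ac)
      qed
      also have "suminf (\<lambda>k. 4 / (t * (real (n + k) + 1))\<^sup>2) = 4 / t\<^sup>2 * (\<Sum>k. 1 / (real (n + k) + 1)\<^sup>2)"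
      proof -
        from suminf_mult[OF summable_inverse_square_shift[of n], of "4 / t\<^sup>2"] show ?thesis
          by (simp add: power_mult_distrib add_ac)
      qed
      finally have bound: "norm (R n t - 1) \<le> \<delta> n"
        using elim by (simp add: \<delta>_def mult.assoc)

      have nz1: "qprod (q t) (z n t) \<noteq> 0"
        using norm1[of 0 0] M elim by (intro qprod_nonzero_ball) simp
      have nz2: "qprod (q t) (z n t * E t) \<noteq> 0"
        using norm1[OF Ms, of 0] by (intro qprod_nonzero_ball) (simp add: E_def)
      have "qprod (q t) (- q t) = (\<Prod>k<N n. 1 + (- q t) * q t ^ k) * qprod (q t) (- q t * q t ^ N n)"
        by (rule qprod_rec_power)
      hence 1: "qprod (q t) (- q t) = (\<Prod>k<N n. 1 - q t ^ Suc k) * qprod (q t) (z n t)"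
        by (simp add: z_def)
      have "qprod (q t) (- (q t * E t)) = (\<Prod>k<N n. 1 + (- (q t * E t)) * q t ^ k) * qprod (q t) (- (q t * E t) * q t ^ N n)"
        by (rule qprod_rec_power)
      hence 2: "qprod (q t) (- (q t * E t)) = (\<Prod>k<N n. 1 - q t ^ Suc k * E t) * qprod (q t) (z n t * E t)"
        by (simp add: z_def mult_ac)
      have 3: "s * Ln (1 + z n t) - s * of_real (ln (1 - exp (- t))) = s * of_real (ln (\<Sum>i<Suc (N n). exp (- t) ^ i))"
      proof -
        have p: "1 - exp (- t) ^ Suc (N n) > 0"
          using x01 by (simp add: power_less_one_iff del: power_Suc)
        have "1 + z n t = of_real (1 - exp (- t) ^ Suc (N n))"
          by (simp add: z_def q_def)
        hence "Ln (1 + z n t) = of_real (ln (1 - exp (- t) ^ Suc (N n)))"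
          using Ln_of_real[OF p] by simp
        also have sum: "1 - exp (- t) ^ Suc (N n) = (1 - exp (- t)) * (\<Sum>i<Suc (N n). exp (- t) ^ i)"
          by (rule one_diff_power_eq)
        hence "ln (1 - exp (- t) ^ Suc (N n)) = ln (1 - exp (- t)) + ln (\<Sum>i<Suc (N n). exp (- t) ^ i)"
          unfolding sum using x01 by (intro ln_mult_pos sum_pos) auto
        finally show ?thesis by (simp add: algebra_simps)
      qed
      have "f t * R n t = (\<Prod>k<N n. 1 - q t ^ Suc k) / (\<Prod>k<N n. 1 - q t ^ Suc k * E t) *
              (exp (- (s * of_real (ln (1 - exp (- t))))) * exp (s * Ln (1 + z n t)))"
        unfolding f_def R_def 1 2 using nz1 nz2 by simp
      also have "exp (- (s * of_real (ln (1 - exp (- t))))) * exp (s * Ln (1 + z n t)) =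
                   exp (s * of_real (ln (\<Sum>i<Suc (N n). exp (- t) ^ i)))"
        unfolding exp_add[symmetric] 3[symmetric] by (simp add: algebra_simps)
      also have "(\<Prod>k<N n. 1 - q t ^ Suc k) / (\<Prod>k<N n. 1 - q t ^ Suc k * E t) =
                   (\<Prod>k<N n. (1 - q t ^ Suc k) / (1 - q t ^ Suc k * E t))"
        by (rule prod_dividef[symmetric])
      finally have "f t * R n t = A n t" unfolding A_def .
      with bound show ?case by simp
    qed
    have factor: "((\<lambda>t. (1 - q t ^ Suc k) / (1 - q t ^ Suc k * E t)) \<longlongrightarrow> of_nat (Suc k) / (of_nat (Suc k) + s)) (at_right 0)" for k
    proof -
      have "(1 - q t ^ Suc k) / (1 - q t ^ Suc k * E t) =
              (1 - exp (- (of_real t * of_nat (Suc k)))) / (1 - exp (- (of_real t * (of_nat (Suc k) + s))))" for t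
        unfolding q_def q_power_eq E_def exp_add[symmetric] by (simp add: algebra_simps)
      thus ?thesis using q_quotient_tendsto[OF s_nz] by simp
    qed
    have "((\<lambda>t. \<Sum>i<Suc (N n). exp (- t) ^ i) \<longlongrightarrow> (\<Sum>i<Suc (N n). exp (- 0) ^ i)) (at_right (0::real))"
      by (intro tendsto_intros)
    hence geo: "((\<lambda>t. \<Sum>i<Suc (N n). exp (- t) ^ i) \<longlongrightarrow> real (Suc (N n))) (at_right (0::real))"
      by simp
    show "(A n \<longlongrightarrow> a n) (at_right 0)"
      unfolding A_def a_def
      by (intro tendsto_mult tendsto_prod factor tendsto_exp tendsto_const tendsto_of_real tendsto_ln geo) simp
  next
    \<comment> \<open>At index N + 1 the Pochhammer symbol in \<open>Gamma_series'\<close> has one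
      factor more than the product in \<open>a\<close>; the correction (1 + s + N) / (N + 1)
      accounts for this and tends to 1.\<close>
    have "(\<lambda>n. Gamma_series' (1 + s) (Suc (N n)) * ((1 + s + of_nat (N n)) / of_nat (Suc (N n)))) \<longlonglongrightarrow> Gamma (1 + s) * 1"
    proof (rule tendsto_mult)
      have fl: "filterlim (\<lambda>n. Suc (N n)) sequentially sequentially"
        unfolding N_def by (rule filterlim_subseq) (auto simp: strict_mono_def)
      show "(\<lambda>n. Gamma_series' (1 + s) (Suc (N n))) \<longlonglongrightarrow> Gamma (1 + s)"
        by (rule filterlim_compose[OF Gamma_series'_LIMSEQ fl])
      have "(\<lambda>n. 1 + s / of_nat n) \<longlonglongrightarrow> 1 + 0"
        by (intro tendsto_intros lim_const_over_n)
      hence "(\<lambda>n. 1 + s / of_nat (Suc (N n))) \<longlonglongrightarrow> 1"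
        using filterlim_compose[OF _ fl] by fastforce
      moreover have "1 + s / of_nat (Suc (N n)) = (1 + s + of_nat (N n)) / of_nat (Suc (N n))" for n
        by (simp add: divide_simps del: of_nat_Suc) simp
      ultimately show "(\<lambda>n. (1 + s + of_nat (N n)) / of_nat (Suc (N n))) \<longlonglongrightarrow> 1" by simp
    qed
    moreover have "Gamma_series' (1 + s) (Suc (N n)) * ((1 + s + of_nat (N n)) / of_nat (Suc (N n))) = a n" for n
    proof -
      have p1: "(\<Prod>k<N n. of_nat (Suc k) :: complex) = fact (N n)"
        by (simp add: fact_prod_Suc atLeast0LessThan)
      have p2: "(\<Prod>k<N n. of_nat (Suc k) + s) = pochhammer (1 + s) (N n)"
        by (simp add: pochhammer_prod atLeast0LessThan add_ac)
      have e: "exp ((1 + s) * of_real (ln (real (Suc (N n))))) = of_nat (Suc (N n)) * exp (s * of_real (ln (real (Suc (N n)))))"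
        by (simp add: distrib_right exp_add exp_of_real del: of_nat_Suc) 
      have nz: "1 + s + of_nat (N n) \<noteq> 0" using s_nz[of "N n"] by (simp add: add_ac)
      show ?thesis
        unfolding Gamma_series'_def a_def prod_dividef p1 p2 pochhammer_Suc using nz e by (simp del: of_nat_Suc)
    qed
    ultimately show "a \<longlonglongrightarrow> Gamma (1 + s)" by simp
  next
    have "\<delta> \<longlonglongrightarrow> exp (8 * M\<^sup>2 * 0) - 1"
      unfolding \<delta>_def by (intro tendsto_intros inverse_square_tail_tendsto)
    thus "\<delta> \<longlonglongrightarrow> 0" by simp
  qed
  thus ?thesis unfolding f_def E_def .
qed

section \<open>The limit\<close>

text \<open>
  The theta functions at the small arguments are moved into a compact region by theta
  quasi-periodicity: \<open>1 - q = \<rho> q\<^sup>N\<close> with \<open>q < \<rho> \<le> 1\<close>.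
\<close>

lemma qBorelLaplace_tendsto:
  fixes \<alpha> l x :: complex
  defines "q \<equiv> \<lambda>t. complex_of_real (exp (- t))"
  assumes l: "l \<notin> \<real>\<^sub>\<le>\<^sub>0" and x: "x \<noteq> 0" "x / l \<notin> \<real>\<^sub>\<le>\<^sub>0" and \<alpha>: "1 - \<alpha> \<notin> \<int>\<^sub>\<le>\<^sub>0"
  shows "((\<lambda>t. qBorelLaplace (q t) l (psi10 (exp (- (of_real t * \<alpha>))) (q t)) (x / (1 - q t)))
          \<longlongrightarrow> Gamma (1 - \<alpha>) * powr_along l x (- \<alpha>) * exp (1 / x)) (at_right 0)"
proof -
  have l0: "l \<noteq> 0" using l by auto
  define a where "a = (\<lambda>t. exp (- (complex_of_real t * \<alpha>)))"
  define b where "b = (\<lambda>t. exp (- (complex_of_real t * (- \<alpha>))))"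
  have ab: "a t * b t = 1" "b t = 1 / a t" for t
    by (simp_all add: a_def b_def exp_minus divide_inverse)
  define N where "N = (\<lambda>t::real. nat \<lfloor>- ln (1 - exp (- t)) / t\<rfloor>)"
  \<comment> \<open>The logarithm of \<open>\<rho>\<close>; being between - t and 0, it vanishes in
    the limit.\<close>
  define r where "r = (\<lambda>t. ln (1 - exp (- t)) + t * real (N t))"
  define Y where "Y = (\<lambda>t. of_real (exp (r t)) * (l / x))"

  have r: "- t < r t \<and> r t \<le> 0" if t: "t > 0" for t
  proof -
    define u where "u = - ln (1 - exp (- t)) / t"
    have "u \<ge> 0" unfolding u_def using t by (intro divide_nonneg_pos) auto
    hence "real (N t) = of_int \<lfloor>u\<rfloor>" by (simp add: N_def u_def)
    hence "real (N t) \<le> u" "u < real (N t) + 1" by linarith+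
    hence "t * real (N t) \<le> t * u" "t * u < t * (real (N t) + 1)"
      using t by (auto intro: mult_left_mono)
    moreover have "t * u = - ln (1 - exp (- t))" using t by (simp add: u_def)
    ultimately show ?thesis by (simp add: r_def algebra_simps)
  qed
  have r_lim: "(r \<longlongrightarrow> 0) (at_right 0)"
  proof (rule tendsto_sandwich)
    show "eventually (\<lambda>t. - t \<le> r t) (at_right 0)" "eventually (\<lambda>t. r t \<le> 0) (at_right 0)"
      using eventually_at_right_less[of "0::real"] by (auto elim!: eventually_mono dest!: r)
    have "((\<lambda>t::real. - t) \<longlongrightarrow> - 0) (at_right 0)" by (intro tendsto_intros)
    thus "((\<lambda>t::real. - t) \<longlongrightarrow> 0) (at_right 0)" by simp
  qed auto
  have Y_lim: "(Y \<longlongrightarrow> l / x) (at_right 0)"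
  proof -
    have "(Y \<longlongrightarrow> of_real (exp 0) * (l / x)) (at_right 0)"
      unfolding Y_def by (intro tendsto_intros r_lim x)
    thus ?thesis by simp
  qed
  have q_lim: "(q \<longlongrightarrow> 1) (at_right 0)" and b_lim: "(b \<longlongrightarrow> 1) (at_right 0)"
  proof -
    have "(q \<longlongrightarrow> complex_of_real (exp (- 0))) (at_right 0)"
      unfolding q_def by (intro tendsto_intros)
    thus "(q \<longlongrightarrow> 1) (at_right 0)" by simp
    have "(b \<longlongrightarrow> exp (- (complex_of_real 0 * (- \<alpha>)))) (at_right 0)"
      unfolding b_def by (intro tendsto_intros)
    thus "(b \<longlongrightarrow> 1) (at_right 0)" by simp
  qed
  have lx: "l / x \<notin> \<real>\<^sub>\<le>\<^sub>0"
  proof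
    assume "l / x \<in> \<real>\<^sub>\<le>\<^sub>0"
    then obtain c where c: "l / x = of_real c" "c \<le> 0" by (auto elim!: nonpos_Reals_cases)
    have "x / l = 1 / (l / x)" by simp
    also have "\<dots> = of_real (1 / c)" using c by simp
    finally have "x / l = of_real (1 / c)" .
    moreover have "1 / c \<le> 0" using c by (simp add: divide_le_0_iff)
    ultimately show False using x by (metis nonpos_Reals_of_real_iff)
  qed

  define F1 where "F1 = (\<lambda>t. theta (q t) (l * a t) / theta (q t) l)"
  define F2 where "F2 = (\<lambda>t. theta (q t) (Y t * b t) / theta (q t) (Y t))"
  define F3 where "F3 = (\<lambda>t. qprod (q t) (- q t) / qprod (q t) (- (q t * b t)) *
                     exp (- ((- \<alpha>) * of_real (ln (1 - exp (- t))))))"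
  define F4 where "F4 = (\<lambda>t. qprod (q t) ((1 - q t) * (- b t / x)))"
  have F1: "(F1 \<longlongrightarrow> exp (- (\<alpha> * Ln l))) (at_right 0)"
    unfolding F1_def q_def a_def by (rule theta_ratio_tendsto[OF tendsto_const l])
  have F2: "(F2 \<longlongrightarrow> exp (- ((- \<alpha>) * Ln (l / x)))) (at_right 0)"
    unfolding F2_def q_def b_def by (rule theta_ratio_tendsto[OF Y_lim lx])
  have F3: "(F3 \<longlongrightarrow> Gamma (1 + (- \<alpha>))) (at_right 0)"
    unfolding F3_def q_def b_def by (rule q_Gamma_tendsto) (use \<alpha> in simp)
  have F4: "(F4 \<longlongrightarrow> exp (- 1 / x)) (at_right 0)"
    unfolding F4_def q_def by (intro qprod_tendsto_exp tendsto_intros b_lim x)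
  have "((\<lambda>t. F1 t * F2 t * exp (- (\<alpha> * of_real (r t))) * F3 t / F4 t) \<longlongrightarrow>
          exp (- (\<alpha> * Ln l)) * exp (- ((- \<alpha>) * Ln (l / x))) * exp (- (\<alpha> * of_real 0)) *
          Gamma (1 + (- \<alpha>)) / exp (- 1 / x)) (at_right 0)"
    by (intro tendsto_intros F1 F2 F3 F4 r_lim) auto
  \<comment> \<open>The theta quotients bring the principal logarithms of l and of l / x. Their
    difference is the logarithm of x cut along the ray through - l, which need not be the principal
    one.\<close>
  also have "exp (- (\<alpha> * Ln l)) * exp (- ((- \<alpha>) * Ln (l / x))) * exp (- (\<alpha> * of_real 0)) *
               Gamma (1 + (- \<alpha>)) / exp (- 1 / x) = Gamma (1 - \<alpha>) * powr_along l x (- \<alpha>) * exp (1 / x)"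
  proof -
    have "Ln (l / x) = - Ln (x / l)"
      using Ln_inverse[OF x(2)] by simp
    hence "exp (- (\<alpha> * Ln l)) * exp (- ((- \<alpha>) * Ln (l / x))) = powr_along l x (- \<alpha>)"
      unfolding powr_along_def exp_add[symmetric] by (simp add: algebra_simps)
    thus ?thesis by (simp add: exp_minus divide_inverse)
  qed
  finally have lim: "((\<lambda>t. F1 t * F2 t * exp (- (\<alpha> * of_real (r t))) * F3 t / F4 t) \<longlongrightarrow>
      Gamma (1 - \<alpha>) * powr_along l x (- \<alpha>) * exp (1 / x)) (at_right 0)" .

  \<comment> \<open>For t this small, an equality a = q^(k+1) would force equality of the exponents,
    hence \<alpha> = k + 1, a pole of Gamma (1 - \<alpha>).\<close>
  have "((\<lambda>t::real. \<bar>t * Im \<alpha>\<bar>) \<longlongrightarrow> \<bar>0 * Im \<alpha>\<bar>) (at_right 0)"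
    by (intro tendsto_intros)
  hence ev1: "eventually (\<lambda>t::real. \<bar>t * Im \<alpha>\<bar> < 2 * pi) (at_right 0)"
    by (rule order_tendstoD) auto
  \<comment> \<open>The inner Ramanujan sum converges for small t because x / (1 - q) tends to
    infinity.\<close>
  have "((\<lambda>t. norm ((1 - q t) * (b t / x))) \<longlongrightarrow> norm ((1 - 1) * (1 / x))) (at_right 0)"
    by (intro tendsto_intros q_lim b_lim x)
  hence ev2: "eventually (\<lambda>t. norm ((1 - q t) * (b t / x)) < 1) (at_right 0)"
    by (rule order_tendstoD) auto
  have "eventually (\<lambda>t. F1 t * F2 t * exp (- (\<alpha> * of_real (r t))) * F3 t / F4 t =
          qBorelLaplace (q t) l (psi10 (a t) (q t)) (x / (1 - q t))) (at_right 0)"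
    using eventually_at_right_less[of "0::real"] ev1 ev2
  proof eventually_elim
    case (elim t)
    interpret nome "q t" unfolding q_def using elim by (intro nome_exp)
    have qt1: "1 - q t \<noteq> 0" using norm_q by auto
    have a: "a t \<noteq> q t ^ Suc k" for k
    proof
      assume "a t = q t ^ Suc k"
      hence "exp (- (complex_of_real t * \<alpha>)) = exp (- (of_real t * of_nat (Suc k)))"
        unfolding a_def q_def q_power_eq .
      hence "- (complex_of_real t * \<alpha>) = - (of_real t * of_nat (Suc k))"
        by (rule exp_complex_eqI[rotated]) (use elim in simp)
      hence "\<alpha> = of_nat (Suc k)" using elim by simp
      hence "1 - \<alpha> = - of_nat k" by simp
      with \<alpha> show False by simp
    qed
    have a0: "a t \<noteq> 0" by (simp add: a_def)
    have l_nz: "1 + l * q t powi n \<noteq> 0" for n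
    proof
      assume "1 + l * q t powi n = 0"
      hence "l * q t powi n = - 1" by (simp add: add_eq_0_iff)
      hence "l = - 1 / q t powi n" using q_nz by (simp add: field_simps)
      also have "\<dots> = of_real (- 1 / exp (- t) powi n)" by (simp add: q_def)
      finally have "l = of_real (- 1 / exp (- t) powi n)" .
      moreover have "- 1 / exp (- t) powi n \<le> 0" by simp
      ultimately show False using l by (metis nonpos_Reals_of_real_iff)
    qed
    have Y0: "Y t \<noteq> 0" using l0 x by (simp add: Y_def)
    have inv: "1 / (a t * (x / (1 - q t))) = (1 - q t) * (b t / x)"
      using ab[of t] by (simp add: divide_inverse mult_ac)
    have Yq: "l / (x / (1 - q t)) = Y t * q t powi int (N t)"
    proof -
      have "exp (r t) * exp (- t) ^ N t = 1 - exp (- t)"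
        unfolding r_def exp_of_nat_mult[symmetric] exp_add[symmetric]
        using elim by (simp add: mult.commute)
      hence "complex_of_real (exp (r t)) * q t ^ N t = 1 - q t"
        unfolding q_def by (metis of_real_1 of_real_diff of_real_mult of_real_power)
      thus ?thesis by (simp add: Y_def mult_ac)
    qed
    have "l / (a t * (x / (1 - q t))) = l / (x / (1 - q t)) * b t"
      using ab[of t] by (simp add: divide_inverse mult_ac)
    hence Yb: "l / (a t * (x / (1 - q t))) = (Y t * b t) * q t powi int (N t)"
      unfolding Yq by (simp add: mult_ac)
    have th: "theta (q t) (l / (a t * (x / (1 - q t)))) / theta (q t) (l / (x / (1 - q t))) = F2 t / b t ^ N t"
    proof -
      have "b t \<noteq> 0" by (simp add: b_def)
      thus ?thesis
        unfolding Yb Yq using Y0 q_nz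
        by (subst (1 2) theta_shift) (auto simp: F2_def power_mult_distrib)
    qed
    \<comment> \<open>Since t N = r - ln (1 - q), the power left over by the theta shift splits off
      (1 - q)^\<alpha>, which is exactly the normalisation of the q-Gamma quotient in
      \<open>F3\<close>.\<close>
    have E: "1 / b t ^ N t = exp (- (\<alpha> * of_real (r t))) * exp (- ((- \<alpha>) * of_real (ln (1 - exp (- t)))))"
    proof -
      have "b t ^ N t = exp (of_nat (N t) * (- (complex_of_real t * (- \<alpha>))))"
        unfolding b_def by (rule exp_of_nat_mult[symmetric])
      hence "1 / b t ^ N t = exp (- (of_nat (N t) * (- (complex_of_real t * (- \<alpha>)))))"
        by (simp only: exp_minus divide_inverse mult_1_left)
      thus ?thesis unfolding exp_add[symmetric] by (simp add: r_def algebra_simps)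
    qed
    have "qBorelLaplace (q t) l (psi10 (a t) (q t)) (x / (1 - q t)) =
            theta (q t) (a t * l) * theta (q t) (l / (a t * (x / (1 - q t)))) /
           (theta (q t) (l / (x / (1 - q t))) * qprod (q t) l * qprod (q t) (q t / l) * 
             qprod (q t) (- q t / a t) * qprod (q t) (- 1 / (a t * (x / (1 - q t)))))"
      by (intro qBorelLaplace_psi10 a a0 l0 l_nz) (use x qt1 elim in \<open>auto simp only: inv divide_eq_0_iff\<close>)
    also have "- 1 / (a t * (x / (1 - q t))) = (1 - q t) * (- b t / x)"
      unfolding minus_divide_left[symmetric] inv by simp
    also have "- q t / a t = - (q t * b t)"
      using ab by simp
    also have "theta (q t) (a t * l) * theta (q t) (l / (a t * (x / (1 - q t)))) /
           (theta (q t) (l / (x / (1 - q t))) * qprod (q t) l * qprod (q t) (q t / l) * 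
             qprod (q t) (- (q t * b t)) * qprod (q t) ((1 - q t) * (- b t / x))) =
           theta (q t) (l * a t) / (qprod (q t) l * qprod (q t) (q t / l)) *
           (theta (q t) (l / (a t * (x / (1 - q t)))) / theta (q t) (l / (x / (1 - q t)))) /
           qprod (q t) (- (q t * b t)) / qprod (q t) ((1 - q t) * (- b t / x))"
      by (simp add: mult.commute)
    also have "theta (q t) (l * a t) / (qprod (q t) l * qprod (q t) (q t / l)) = F1 t * qprod (q t) (- q t)"
      unfolding F1_def using jacobi_triple_product[OF l0] qprod_minus_q_nz by simp
    also have "F1 t * qprod (q t) (- q t) * 
           (theta (q t) (l / (a t * (x / (1 - q t)))) / theta (q t) (l / (x / (1 - q t)))) /
           qprod (q t) (- (q t * b t)) / qprod (q t) ((1 - q t) * (- b t / x)) =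
           F1 t * F2 t * (1 / b t ^ N t) * (qprod (q t) (- q t) / qprod (q t) (- (q t * b t))) / F4 t"
      unfolding th F4_def by simp
    also have "\<dots> = F1 t * F2 t * exp (- (\<alpha> * of_real (r t))) * F3 t / F4 t"
      unfolding E F3_def by simp
    finally show ?case ..
  qed
  from Lim_transform_eventually[OF lim this] show ?thesis
    unfolding a_def .
qed

theorem theorem4:
  fixes \<alpha> l x :: complex
  assumes "l \<noteq> 0" and "l \<notin> \<real>\<^sub>\<le>\<^sub>0"
    and "x \<noteq> 0" and "x / l \<notin> \<real>\<^sub>\<le>\<^sub>0"
    and "1 - \<alpha> \<notin> \<int>\<^sub>\<le>\<^sub>0"
  shows "((\<lambda>q::real. qBorelLaplace (of_real q) l (psi10 (of_real q powr \<alpha>) (of_real q))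
                       (x / (1 - of_real q)))
          \<longlongrightarrow> Gamma (1 - \<alpha>) * powr_along l x (- \<alpha>) * exp (1 / x)) (at_left 1)"
proof -
  have "filterlim (\<lambda>q::real. - ln q) (at_right 0) (at_left 1)"
    by real_asymp
  from filterlim_compose[OF qBorelLaplace_tendsto[OF assms(2-5)] this]
  have "((\<lambda>q::real. qBorelLaplace (of_real (exp (- (- ln q)))) l
           (psi10 (exp (- (of_real (- ln q) * \<alpha>))) (of_real (exp (- (- ln q)))))
                       (x / (1 - of_real (exp (- (- ln q))))))
          \<longlongrightarrow> Gamma (1 - \<alpha>) * powr_along l x (- \<alpha>) * exp (1 / x)) (at_left 1)" .
  moreover have "eventually (\<lambda>q::real. q \<in> {0<..<1}) (at_left 1)"
    by (rule eventually_at_left_real) simp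
  hence "eventually (\<lambda>q::real. qBorelLaplace (of_real (exp (- (- ln q)))) l
           (psi10 (exp (- (of_real (- ln q) * \<alpha>))) (of_real (exp (- (- ln q)))))
                       (x / (1 - of_real (exp (- (- ln q))))) =
         qBorelLaplace (of_real q) l (psi10 (of_real q powr \<alpha>) (of_real q)) (x / (1 - of_real q))) (at_left 1)"
  proof eventually_elim
    case (elim q)
    hence "exp (- (of_real (- ln q) * \<alpha>)) = complex_of_real q powr \<alpha>"
      by (simp add: powr_def Ln_of_real mult.commute)
    moreover have "exp (- (- ln q)) = q" using elim by simp
    ultimately show ?case by (simp only:)
  qed
  ultimately show ?thesis
    by (rule Lim_transform_eventually)
qed

end
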